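(* Consider the simplified game of baccara banque with parameter $\theta\in(0,1/2]$ in which the two Players form a coalition against Banker but must act independently (see context). Let $\theta_{**}\approx 0.496212$ be the root (with that approximate value) of the degree-8 polynomial $$139587367297173051168-135782955080259495272577\,\theta+1873662221810254572134561\,\theta^2-6306085403811779286897552\,\theta^3+3889005095548638820291008\,\theta^4+4461194696950345843390464\,\theta^5+13439789031937874190594048\,\theta^6-35092289343041827660431360\,\theta^7+17873545461788238682521600\,\theta^8 .$$ For every $\theta\in(\theta_{**},1/2]$ the Players' maximin strategy is $(p_1(\theta),p_2(\theta))$ with $$p_1(\theta)=\frac{-6191+932160\,\theta-1065024\,\theta^2-s(\theta)}{32(151-12928\,\theta+8256\,\theta^2)},\qquad p_2(\theta)=\frac{139055-1197888\,\theta+1065024\,\theta^2+s(\theta)}{32(4521+3584\,\theta-8256\,\theta^2)},$$ where $s(\theta)=\sqrt{[20687-1065024\,\theta(1-\theta)]\,[20687-1556544\,\theta(1-\theta)]}$; Banker's best response to it is as prescribed by Table 1 (see context), Banker being indifferent precisely on $(6,10,6)$ and $(10,6,6)$; and the lower value of the game (to the Players) is $$\underline v(\theta)=-\frac{N(\theta)-3\,(980324411-4975425984\,\theta(1-\theta))\,s(\theta)}{21208998746\,(151-12928\,\theta+8256\,\theta^2)(4521+3584\,\theta-8256\,\theta^2)},$$ where $N(\theta)=94430296089921-6646323952883456\,\theta-25262343281817856\,\theta^2+63817334469402624\,\theta^3-31908667234701312\,\theta^4$. In particular, for $\theta=1/2$, $p_1=p_2=\frac{-319+\sqrt{245569}}{224}$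 and the lower value is $\frac{5(-1933207795+260493\sqrt{245569})}{98\cdot 13^9}$.
   Context: Simplified game of baccara banque. Let $X_1,X_2,Y$ be i.i.d. on $\{0,\ldots,9\}$ with $P(\cdot=i)=q(i)=(16+9\delta_{i,0})/13^2$ (two-card totals of Player 1, Player 2, Banker), and let $X_1',X_2',Y'$ be i.i.d. on $\{0,\ldots,9\}$, independent of these, with $P(\cdot=k)=q'(k)=(1+3\delta_{k,0})/13$ (third-card values). $M(i)$ is the remainder of $i$ modulo $10$. Player $i$'s pure strategies are $u_i\in\{0,1\}$ ($0$ = stand on two-card total 5, $1$ = draw on 5); Player $i$ draws iff $X_i\le 4+u_i$. Put $K_i=X_i'$ if $X_i\le 4+u_i$, $K_i=10$ if $5+u_i\le X_i\le 7$ (stand), $K_i=11$ if $X_i\in\{8,9\}$ (natural); put $F_i=M(X_i+X_i')$ if $X_i\le 4+u_i$ and $F_i=X_i$ otherwise. Banker's information sets are the 1144 triples $(k_1,k_2,j)\in I:=[\{0,\ldots,11\}^2\setminus\{(11,11)\}]\times\{0,\ldots,7\}$; a Banker pure strategy is a subset $T\subset I$, the set on which he draws. If $Y\ge 8$ or both $X_1,X_2\ge 8$, set $G_i=\mathrm{sgn}(X_i-Y)$. Otherwise let $B=M(Y+Y')$ if $(K_1,K_2,Y)\in T$ and $B=Y$ if not, and set $G_i=1$ if $X_i\ge 8$ and $G_i=\mathrm{sgn}(F_i-B)$ if $X_i\le 7$. The joint payoff to the Players is $a_{u_1,u_2,T}(\theta)=E[\theta G_1+(1-\theta)G_2]$;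 the payoff to Banker is $-a_{u_1,u_2,T}(\theta)$. For $p_1,p_2\in[0,1]$ (the probabilities with which Players 1 and 2 independently draw on 5) let $a_T(\theta;p_1,p_2)=(1-p_1)(1-p_2)a_{0,0,T}(\theta)+(1-p_1)p_2a_{0,1,T}(\theta)+p_1(1-p_2)a_{1,0,T}(\theta)+p_1p_2a_{1,1,T}(\theta)$. The Players' maximin strategy is the maximizer $(p_1,p_2)\in[0,1]^2$ of $E_\theta^0(p_1,p_2)=\min_{T\subset I}a_T(\theta;p_1,p_2)$, and the lower value $\underline v(\theta)$ is the maximum of $E^0_\theta$. Banker's best response to $(p_1,p_2)$ is any minimizing $T$. Table 1 (Banker's maximum drawing total as a function of $k_1$ (row) and $k_2$ (column), columns $k_2=0,1,\ldots,11$). An entry $m$ means: draw on $j\le m$, stand on $j>m$. An entry $5{+}$ means: draw on $j\le 5$, indifferent on $j=6$, stand on $j=7$. $k_1=0$: 3,3,3,4,4,4,4,3,3,3,5,3; $k_1=1$: 3,3,4,4,4,4,4,4,3,3,5,3; $k_1=2$: 3,4,4,4,4,4,5,4,3,3,5,4; $k_1=3$: 4,4,4,4,4,5,5,4,4,3,5,4; $k_1=4$: 4,4,4,4,5,5,5,5,4,4,5,5; $k_1=5$: 4,4,4,5,5,5,5,5,5,4,5,5; $k_1=6$: 4,4,5,5,5,5,6,6,5,4,5+,6; $k_1=7$: 3,4,4,4,5,5,6,6,3,3,6,6; $k_1=8$: 3,3,3,4,4,5,5,3,2,3,5,2; $k_1=9$: 3,3,3,3,4,4,4,3,3,3,5,3;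 $k_1=10$: 5,5,5,5,5,5,5+,6,5,5,5,5; $k_1=11$: 3,3,4,4,5,5,6,6,2,3,5,(none). *)

theory Defs
  imports "HOL-Probability.Probability" "HOL-Computational_Algebra.Polynomial"
begin

definition two_card_prob :: "nat \<Rightarrow> real" where
  "two_card_prob i = (16 + 9 * of_bool (i = 0)) / 13\<^sup>2"

definition third_card_prob :: "nat \<Rightarrow> real" where
  "third_card_prob k = (1 + 3 * of_bool (k = 0)) / 13"

definition two_card_pmf :: "nat pmf" where
  "two_card_pmf = embed_pmf (\<lambda>i. if i \<le> 9 then two_card_prob i else 0)"

definition third_card_pmf :: "nat pmf" where
  "third_card_pmf = embed_pmf (\<lambda>k. if k \<le> 9 then third_card_prob k else 0)"

lemma pmf_embed_digits:
  fixes f :: "nat \<Rightarrow> real"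
  assumes "\<And>i. 0 \<le> f i" and "(\<Sum>i\<le>9. f i) = 1"
  shows "pmf (embed_pmf (\<lambda>i. if i \<le> 9 then f i else 0)) i = (if i \<le> 9 then f i else 0)"
proof (rule pmf_embed_pmf)
  have "(\<integral>\<^sup>+ i. ennreal (if i \<le> 9 then f i else 0) \<partial>count_space UNIV)
      = (\<Sum>i\<le>9. ennreal (if i \<le> 9 then f i else 0))"
    by (rule nn_integral_count_space') auto
  also have "\<dots> = (\<Sum>i\<le>9. ennreal (f i))"
    by (rule sum.cong) auto
  also have "\<dots> = ennreal (\<Sum>i\<le>9. f i)"
    using assms(1) by (subst sum_ennreal) auto
  finally show "(\<integral>\<^sup>+ i. ennreal (if i \<le> 9 then f i else 0) \<partial>count_space UNIV) = 1"
    using assms(2) by simp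
qed (use assms(1) in auto)

lemma pmf_two_card_pmf:
  "pmf two_card_pmf i = (if i \<le> 9 then two_card_prob i else 0)"
  unfolding two_card_pmf_def
  by (rule pmf_embed_digits) (simp_all add: two_card_prob_def eval_nat_numeral)

lemma pmf_third_card_pmf:
  "pmf third_card_pmf k = (if k \<le> 9 then third_card_prob k else 0)"
  unfolding third_card_pmf_def
  by (rule pmf_embed_digits) (simp_all add: third_card_prob_def eval_nat_numeral)

text \<open>Joint law of \<open>(X1, X2, Y, X1', X2', Y')\<close>; independence is the product law.\<close>

definition deal_pmf :: "(nat \<times> nat \<times> nat \<times> nat \<times> nat \<times> nat) pmf" where
  "deal_pmf = pair_pmf two_card_pmf (pair_pmf two_card_pmf (pair_pmf two_card_pmf
     (pair_pmf third_card_pmf (pair_pmf third_card_pmf third_card_pmf))))"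

text \<open>In the following, \<open>u\<close> is a Player's pure strategy: 0 to stand and 1 to draw on 5.\<close>

definition player_signal :: "nat \<Rightarrow> nat \<Rightarrow> nat \<Rightarrow> nat" where
  "player_signal u x x' = (if x \<le> 4 + u then x' else if x \<le> 7 then 10 else 11)"

definition player_total :: "nat \<Rightarrow> nat \<Rightarrow> nat \<Rightarrow> nat" where
  "player_total u x x' = (if x \<le> 4 + u then (x + x') mod 10 else x)"

definition info_sets :: "(nat \<times> nat \<times> nat) set" where
  "info_sets = {(k1, k2, j). k1 \<le> 11 \<and> k2 \<le> 11 \<and> (k1, k2) \<noteq> (11, 11) \<and> j \<le> 7}"

lemma finite_info_sets: "finite info_sets"
  by (rule finite_subset[of _ "{..11} \<times> {..11} \<times> {..7}"]) (auto simp: info_sets_def)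

definition banker_total :: "(nat \<times> nat \<times> nat) set \<Rightarrow> nat \<Rightarrow> nat \<Rightarrow> nat \<Rightarrow> nat \<Rightarrow> nat" where
  "banker_total T k1 k2 y y' = (if (k1, k2, y) \<in> T then (y + y') mod 10 else y)"

definition no_draw_round :: "nat \<Rightarrow> nat \<Rightarrow> nat \<Rightarrow> bool" where
  "no_draw_round x1 x2 y \<longleftrightarrow> y \<ge> 8 \<or> (x1 \<ge> 8 \<and> x2 \<ge> 8)"

text \<open>\<open>G\<^sub>i\<close> as a function of whether the coup ends before the third cards, the Player's two-card
  total \<open>x\<close> and final total \<open>f\<close>, and Banker's two-card total \<open>y\<close> and final total \<open>b\<close>.\<close>

definition hand_result :: "bool \<Rightarrow> nat \<Rightarrow> nat \<Rightarrow> nat \<Rightarrow> nat \<Rightarrow> real" where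
  "hand_result ended x f y b =
     (if ended then sgn (real x - real y)
      else if x \<ge> 8 then 1
      else sgn (real f - real b))"

definition pure_payoff :: "nat \<Rightarrow> nat \<Rightarrow> (nat \<times> nat \<times> nat) set \<Rightarrow> real \<Rightarrow> real" where
  "pure_payoff u1 u2 T \<theta> =
     measure_pmf.expectation deal_pmf (\<lambda>(x1, x2, y, x1', x2', y').
       let ended = no_draw_round x1 x2 y;
           b = banker_total T (player_signal u1 x1 x1') (player_signal u2 x2 x2') y y';
           g1 = hand_result ended x1 (player_total u1 x1 x1') y b;
           g2 = hand_result ended x2 (player_total u2 x2 x2') y b
       in \<theta> * g1 + (1 - \<theta>) * g2)"

definition mixed_payoff :: "(nat \<times> nat \<times> nat) set \<Rightarrow> real \<Rightarrow> real \<Rightarrow> real \<Rightarrow> real" where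
  "mixed_payoff T \<theta> p1 p2 =
     (1 - p1) * (1 - p2) * pure_payoff 0 0 T \<theta> + (1 - p1) * p2 * pure_payoff 0 1 T \<theta>
     + p1 * (1 - p2) * pure_payoff 1 0 T \<theta> + p1 * p2 * pure_payoff 1 1 T \<theta>"

definition security_level :: "real \<Rightarrow> real \<Rightarrow> real \<Rightarrow> real" where
  "security_level \<theta> p1 p2 = Min ((\<lambda>T. mixed_payoff T \<theta> p1 p2) ` Pow info_sets)"

definition is_maximin :: "real \<Rightarrow> real \<Rightarrow> real \<Rightarrow> bool" where
  "is_maximin \<theta> p1 p2 \<longleftrightarrow> p1 \<in> {0..1} \<and> p2 \<in> {0..1} \<and>
     (\<forall>r1\<in>{0..1}. \<forall>r2\<in>{0..1}. security_level \<theta> r1 r2 \<le> security_level \<theta> p1 p2)"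

definition lower_value :: "real \<Rightarrow> real" where
  "lower_value \<theta> = (SUP (p1, p2) \<in> {0..1} \<times> {0..1}. security_level \<theta> p1 p2)"

definition is_best_response :: "real \<Rightarrow> real \<Rightarrow> real \<Rightarrow> (nat \<times> nat \<times> nat) set \<Rightarrow> bool" where
  "is_best_response \<theta> p1 p2 T \<longleftrightarrow> T \<subseteq> info_sets \<and>
     (\<forall>T'. T' \<subseteq> info_sets \<longrightarrow> mixed_payoff T \<theta> p1 p2 \<le> mixed_payoff T' \<theta> p1 p2)"

definition banker_indifferent :: "real \<Rightarrow> real \<Rightarrow> real \<Rightarrow> nat \<times> nat \<times> nat \<Rightarrow> bool" where
  "banker_indifferent \<theta> p1 p2 z \<longleftrightarrow>
     (\<forall>T. T \<subseteq> info_sets \<longrightarrow>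
        mixed_payoff (insert z T) \<theta> p1 p2 = mixed_payoff (T - {z}) \<theta> p1 p2)"

text \<open>\<open>Upto m\<close> is the table entry \<open>m\<close>, and \<open>Upto_Plus m\<close> the entry \<open>m+\<close> (indifferent on
  \<open>m + 1\<close>). \<open>No_Entry\<close> fills the position \<open>(11, 11)\<close>, which is not part of \<open>info_sets\<close>.\<close>

datatype table_entry = Upto nat | Upto_Plus nat | No_Entry

datatype advice = Draw | Stand | Draw_Or_Stand

fun entry_advice :: "table_entry \<Rightarrow> nat \<Rightarrow> advice" where
  "entry_advice (Upto m) j = (if j \<le> m then Draw else Stand)"
| "entry_advice (Upto_Plus m) j =
     (if j \<le> m then Draw else if j = m + 1 then Draw_Or_Stand else Stand)"
| "entry_advice No_Entry j = Draw_Or_Stand"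

definition banker_table :: "table_entry list list" where
  "banker_table =
    [[Upto 3, Upto 3, Upto 3, Upto 4, Upto 4, Upto 4, Upto 4, Upto 3, Upto 3, Upto 3, Upto 5, Upto 3],
     [Upto 3, Upto 3, Upto 4, Upto 4, Upto 4, Upto 4, Upto 4, Upto 4, Upto 3, Upto 3, Upto 5, Upto 3],
     [Upto 3, Upto 4, Upto 4, Upto 4, Upto 4, Upto 4, Upto 5, Upto 4, Upto 3, Upto 3, Upto 5, Upto 4],
     [Upto 4, Upto 4, Upto 4, Upto 4, Upto 4, Upto 5, Upto 5, Upto 4, Upto 4, Upto 3, Upto 5, Upto 4],
     [Upto 4, Upto 4, Upto 4, Upto 4, Upto 5, Upto 5, Upto 5, Upto 5, Upto 4, Upto 4, Upto 5, Upto 5],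
     [Upto 4, Upto 4, Upto 4, Upto 5, Upto 5, Upto 5, Upto 5, Upto 5, Upto 5, Upto 4, Upto 5, Upto 5],
     [Upto 4, Upto 4, Upto 5, Upto 5, Upto 5, Upto 5, Upto 6, Upto 6, Upto 5, Upto 4, Upto_Plus 5, Upto 6],
     [Upto 3, Upto 4, Upto 4, Upto 4, Upto 5, Upto 5, Upto 6, Upto 6, Upto 3, Upto 3, Upto 6, Upto 6],
     [Upto 3, Upto 3, Upto 3, Upto 4, Upto 4, Upto 5, Upto 5, Upto 3, Upto 2, Upto 3, Upto 5, Upto 2],
     [Upto 3, Upto 3, Upto 3, Upto 3, Upto 4, Upto 4, Upto 4, Upto 3, Upto 3, Upto 3, Upto 5, Upto 3],
     [Upto 5, Upto 5, Upto 5, Upto 5, Upto 5, Upto 5, Upto_Plus 5, Upto 6, Upto 5, Upto 5, Upto 5, Upto 5],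
     [Upto 3, Upto 3, Upto 4, Upto 4, Upto 5, Upto 5, Upto 6, Upto 6, Upto 2, Upto 3, Upto 5, No_Entry]]"

definition follows_table :: "(nat \<times> nat \<times> nat) set \<Rightarrow> bool" where
  "follows_table T \<longleftrightarrow>
     (\<forall>(k1, k2, j) \<in> info_sets.
        case entry_advice (banker_table ! k1 ! k2) j of
          Draw \<Rightarrow> (k1, k2, j) \<in> T
        | Stand \<Rightarrow> (k1, k2, j) \<notin> T
        | Draw_Or_Stand \<Rightarrow> True)"

definition theta_poly :: "real poly" where
  "theta_poly =
     [:139587367297173051168, -135782955080259495272577, 1873662221810254572134561,
       -6306085403811779286897552, 3889005095548638820291008, 4461194696950345843390464,
       13439789031937874190594048, -35092289343041827660431360, 17873545461788238682521600:]"

text \<open>The tolerance makes \<open>0.496212\<close> the value of the root rounded to six decimals.\<close>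

definition is_theta_ss :: "real \<Rightarrow> bool" where
  "is_theta_ss t \<longleftrightarrow> poly theta_poly t = 0 \<and> \<bar>t - 0.496212\<bar> \<le> 0.0000005"

definition theta_ss :: real where
  "theta_ss = (THE t. is_theta_ss t)"

definition s_root :: "real \<Rightarrow> real" where
  "s_root \<theta> = sqrt ((20687 - 1065024 * \<theta> * (1 - \<theta>)) * (20687 - 1556544 * \<theta> * (1 - \<theta>)))"

definition N_poly :: "real \<Rightarrow> real" where
  "N_poly \<theta> = 94430296089921 - 6646323952883456 * \<theta> - 25262343281817856 * \<theta>^2
     + 63817334469402624 * \<theta>^3 - 31908667234701312 * \<theta>^4"

definition opt_p1 :: "real \<Rightarrow> real" where
  "opt_p1 \<theta> = (- 6191 + 932160 * \<theta> - 1065024 * \<theta>^2 - s_root \<theta>)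
     / (32 * (151 - 12928 * \<theta> + 8256 * \<theta>^2))"

definition opt_p2 :: "real \<Rightarrow> real" where
  "opt_p2 \<theta> = (139055 - 1197888 * \<theta> + 1065024 * \<theta>^2 + s_root \<theta>)
     / (32 * (4521 + 3584 * \<theta> - 8256 * \<theta>^2))"

end

theory Submission
  imports Defs
begin

text \<open>
  Fix the Players' mixed strategies. What Banker gains or loses by drawing rather than standing at
  one information set does not depend on what he does at the others, so the payoff is the payoff
  against a Banker who never draws plus a sum over the information sets at which he draws
  (\<open>mixed_payoff_decomposition\<close>). The minimum over all Banker strategies is therefore taken one
  information set at a time, and only the signs of the 1144 summands \<open>draw_effect\<close> matter
  (\<open>is_best_response_iff\<close>). Up to a positive factor a summand is
  \<open>\<theta> * r1 + (1 - \<theta>) * r2\<close>, where \<open>ri\<close> is the mean change in Player \<open>i\<close>'s result given his signal and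
  Banker's total. For \<open>\<theta>\<close> between 0.4962 and 1/2 and \<open>p1\<close>, \<open>p2\<close> between 0.787 and 0.789 the
  conditional means lie in short intervals, which decide every sign except those at \<open>(6, 10, 6)\<close>
  and \<open>(10, 6, 6)\<close> (\<open>draw_effect_sign\<close>).

  The pair \<open>(opt_p1 \<theta>, opt_p2 \<theta>)\<close> is the point of that square at which these two effects, which are
  bilinear in \<open>(p1, p2)\<close>, vanish simultaneously; eliminating one variable leaves a quadratic
  equation, whence the square root \<open>s_root\<close>. So Banker has four best responses there, and near the
  point the security level is the minimum of four bilinear functions \<open>L\<close>, \<open>L + A\<close>, \<open>L + B\<close> and
  \<open>L + A + B\<close>. It is stationary in the sense that some \<open>L + l * A + m * B\<close> with
  \<open>0 \<le> l \<le> 1\<close> and \<open>0 \<le> m \<le> 1\<close> has gradient zero (\<open>multipliers\<close>). The inequality \<open>l \<le> 1\<close> is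
  the one that fails below \<open>theta_ss\<close>: it reads \<open>U + V * s_root \<theta> \<ge> 0\<close> for certain
  polynomials in \<open>\<theta>\<close>, and \<open>U\<^sup>2 - V\<^sup>2 * (s_root \<theta>)\<^sup>2\<close> is \<open>theta_poly\<close> times a quartic without zeros in the range
  (\<open>norm_identity\<close>, \<open>slope_negative\<close>).

  Bilinear functions are not concave, so stationarity alone does not give a global maximum. But the
  coefficient of the mixed term of \<open>L + l * A + m * B\<close> is negative, so deviations in which both
  Players move in the same direction lose against one of the four responses. If
  they move in opposite directions, then already \<open>L + A\<close> or \<open>L + B\<close> punishes them. Both arguments
  are valid on the whole unit square (\<open>best_reply_bound\<close>), which gives maximality and uniqueness.
\<close>

section \<open>Expectations over a deal\<close>

lemma deal_expectation_eq_sum: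
  "measure_pmf.expectation deal_pmf f =
    (\<Sum>x1\<le>9. \<Sum>x2\<le>9. \<Sum>y\<le>9. \<Sum>x1'\<le>9. \<Sum>x2'\<le>9. \<Sum>y'\<le>9.
       two_card_prob x1 * two_card_prob x2 * two_card_prob y *
       third_card_prob x1' * third_card_prob x2' * third_card_prob y' *
       f (x1, x2, y, x1', x2', y'))"
proof -
  let ?D = "{..9::nat}"
  have "measure_pmf.expectation deal_pmf f =
      (\<Sum>z\<in>?D \<times> ?D \<times> ?D \<times> ?D \<times> ?D \<times> ?D. f z * pmf deal_pmf z)"
  proof (rule integral_measure_pmf_real)
    fix z assume "z \<in> set_pmf deal_pmf"
    then show "z \<in> ?D \<times> ?D \<times> ?D \<times> ?D \<times> ?D \<times> ?D"
      by (auto simp: deal_pmf_def set_pmf_iff pmf_two_card_pmf pmf_third_card_pmf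
            split: if_splits)
  qed auto
  then show ?thesis
    by (simp add: sum.cartesian_product' deal_pmf_def pmf_pair pmf_two_card_pmf
          pmf_third_card_pmf ac_simps)
qed

lemma finite_set_deal_pmf: "finite (set_pmf deal_pmf)"
proof (rule finite_subset)
  let ?D = "{..9::nat}"
  show "set_pmf deal_pmf \<subseteq> ?D \<times> ?D \<times> ?D \<times> ?D \<times> ?D \<times> ?D"
      by (auto simp: deal_pmf_def set_pmf_iff pmf_two_card_pmf pmf_third_card_pmf
            split: if_splits)
qed auto

lemma integrable_deal_pmf [simp]: "integrable (measure_pmf deal_pmf) (f :: _ \<Rightarrow> real)"
  by (rule integrable_measure_pmf_finite) (rule finite_set_deal_pmf)


text \<open>The sums are nested in the order of the components of a deal, so a product of a function of one
  Player's cards (and Banker's) with a function of the other Player's cards can be split by pulling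
  out constant factors alone, without exchanging sums.\<close>

lemma deal_sum_factor1:
  fixes F :: "nat \<Rightarrow> nat \<Rightarrow> nat \<Rightarrow> nat \<Rightarrow> real"
  shows "(\<Sum>x1\<le>9. \<Sum>x2\<le>9. \<Sum>y\<le>9. \<Sum>x1'\<le>9. \<Sum>x2'\<le>9. \<Sum>y'\<le>9. F x1 y x1' y' * G x2 x2') =
     (\<Sum>x1\<le>9. \<Sum>y\<le>9. \<Sum>x1'\<le>9. \<Sum>y'\<le>9. F x1 y x1' y') * (\<Sum>x2\<le>9. \<Sum>x2'\<le>9. G x2 x2')"
  by (simp only: sum_distrib_left [symmetric] sum_distrib_right [symmetric])

lemma deal_sum_factor2:
  fixes F :: "nat \<Rightarrow> nat \<Rightarrow> nat \<Rightarrow> nat \<Rightarrow> real"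
  shows "(\<Sum>x1\<le>9. \<Sum>x2\<le>9. \<Sum>y\<le>9. \<Sum>x1'\<le>9. \<Sum>x2'\<le>9. \<Sum>y'\<le>9. G x1 x1' * F x2 y x2' y') =
     (\<Sum>x1\<le>9. \<Sum>x1'\<le>9. G x1 x1') * (\<Sum>x2\<le>9. \<Sum>y\<le>9. \<Sum>x2'\<le>9. \<Sum>y'\<le>9. F x2 y x2' y')"
  by (simp only: sum_distrib_left [symmetric] sum_distrib_right [symmetric])

lemma deal_expectation_factor1:
  "measure_pmf.expectation deal_pmf (\<lambda>(x1, x2, y, x1', x2', y'). F x1 y x1' y' * G x2 x2') =
   (\<Sum>x\<le>9. \<Sum>y\<le>9. \<Sum>x'\<le>9. \<Sum>y'\<le>9.
      two_card_prob x * two_card_prob y * third_card_prob x' * third_card_prob y' * F x y x' y') *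
   (\<Sum>x\<le>9. \<Sum>x'\<le>9. two_card_prob x * third_card_prob x' * G x x')"
  unfolding deal_expectation_eq_sum deal_sum_factor1 [symmetric]
  by (intro sum.cong refl) (simp add: mult_ac)

lemma deal_expectation_factor2:
  "measure_pmf.expectation deal_pmf (\<lambda>(x1, x2, y, x1', x2', y'). G x1 x1' * F x2 y x2' y') =
   (\<Sum>x\<le>9. \<Sum>x'\<le>9. two_card_prob x * third_card_prob x' * G x x') *
   (\<Sum>x\<le>9. \<Sum>y\<le>9. \<Sum>x'\<le>9. \<Sum>y'\<le>9.
      two_card_prob x * two_card_prob y * third_card_prob x' * third_card_prob y' * F x y x' y')"
  unfolding deal_expectation_eq_sum deal_sum_factor2 [symmetric]
  by (intro sum.cong refl) (simp add: mult_ac)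

section \<open>Additivity of the payoff over Banker's information sets\<close>

text \<open>Player's result against a Banker who never draws. It does not involve the other Player: an early
  end of the coup means that Banker has a natural or that this Player has one, and a Player's
  natural beats any Banker total up to 7.\<close>

definition stand_result :: "nat \<Rightarrow> nat \<Rightarrow> nat \<Rightarrow> nat \<Rightarrow> real" where
  "stand_result u x y x' =
     (if x \<ge> 8 \<or> y \<ge> 8 then sgn (real x - real y) else sgn (real (player_total u x x') - real y))"

text \<open>How Banker's drawing changes the result. A natural already wins against a Banker without one,
  so nothing changes for it.\<close>

definition draw_change :: "nat \<Rightarrow> nat \<Rightarrow> nat \<Rightarrow> nat \<Rightarrow> nat \<Rightarrow> real" where
  "draw_change u x y x' y' =
     (if x \<ge> 8 then 0
      else sgn (real (player_total u x x') - real ((y + y') mod 10))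
           - sgn (real (player_total u x x') - real y))"

definition stand_payoff :: "nat \<Rightarrow> real" where
  "stand_payoff u = (\<Sum>x\<le>9. \<Sum>y\<le>9. \<Sum>x'\<le>9. \<Sum>y'\<le>9.
      two_card_prob x * two_card_prob y * third_card_prob x' * third_card_prob y' *
      stand_result u x y x')"

definition signal_prob :: "nat \<Rightarrow> nat \<Rightarrow> real" where
  "signal_prob u k =
     (\<Sum>x\<le>9. \<Sum>x'\<le>9. two_card_prob x * third_card_prob x' * of_bool (player_signal u x x' = k))"

text \<open>This is the mean change in the result on the event that the signal is \<open>k\<close>, not conditional on
  it; dividing by \<open>signal_prob\<close> gives the conditional mean.\<close>

definition signal_gain :: "nat \<Rightarrow> nat \<Rightarrow> nat \<Rightarrow> real" where
  "signal_gain u k j = (\<Sum>x\<le>9. \<Sum>x'\<le>9. \<Sum>y'\<le>9.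
      two_card_prob x * third_card_prob x' * third_card_prob y' *
      (of_bool (player_signal u x x' = k) * draw_change u x j x' y'))"

text \<open>When the coup ends before the third cards, the triple of signals and Banker's total is not an
  information set, so the correction term vanishes by itself and no case distinction remains.\<close>

lemma hand_result_split:
  fixes T u1 u2 x1 x2 x1' x2' y y'
  defines "z \<equiv> (player_signal u1 x1 x1', player_signal u2 x2 x2', y)"
    and "b \<equiv> banker_total T (player_signal u1 x1 x1') (player_signal u2 x2 x2') y y'"
  assumes T: "T \<subseteq> info_sets" and u: "u1 \<le> 1" "u2 \<le> 1"
  shows "hand_result (no_draw_round x1 x2 y) x1 (player_total u1 x1 x1') y b =
           stand_result u1 x1 y x1' + of_bool (z \<in> T) * draw_change u1 x1 y x1' y'"
    and "hand_result (no_draw_round x1 x2 y) x2 (player_total u2 x2 x2') y b =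
           stand_result u2 x2 y x2' + of_bool (z \<in> T) * draw_change u2 x2 y x2' y'"
proof -
  have "z \<notin> T" if "no_draw_round x1 x2 y"
    using that T u
    by (auto simp: no_draw_round_def z_def player_signal_def info_sets_def)
  then show "hand_result (no_draw_round x1 x2 y) x1 (player_total u1 x1 x1') y b =
           stand_result u1 x1 y x1' + of_bool (z \<in> T) * draw_change u1 x1 y x1' y'"
    and "hand_result (no_draw_round x1 x2 y) x2 (player_total u2 x2 x2') y b =
           stand_result u2 x2 y x2' + of_bool (z \<in> T) * draw_change u2 x2 y x2' y'"
    using u by (auto simp: hand_result_def stand_result_def draw_change_def b_def z_def
        banker_total_def no_draw_round_def player_total_def)
qed

lemma sum_two_card_prob: "(\<Sum>x\<le>9. two_card_prob x) = 1"
  by (simp add: two_card_prob_def eval_nat_numeral)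

lemma sum_third_card_prob: "(\<Sum>k\<le>9. third_card_prob k) = 1"
  by (simp add: third_card_prob_def eval_nat_numeral)

lemma sum_card_probs: "(\<Sum>x\<le>9. \<Sum>x'\<le>9. two_card_prob x * third_card_prob x') = 1"
  by (simp add: sum_distrib_left [symmetric] sum_third_card_prob sum_two_card_prob)

lemma signal_gain_at_total:
  assumes "j \<le> 9"
  shows "(\<Sum>x\<le>9. \<Sum>y\<le>9. \<Sum>x'\<le>9. \<Sum>y'\<le>9.
      two_card_prob x * two_card_prob y * third_card_prob x' * third_card_prob y' *
      (of_bool (player_signal u x x' = k) * of_bool (y = j) * draw_change u x y x' y'))
    = two_card_prob j * signal_gain u k j"
proof -
  have "(\<Sum>x\<le>9. \<Sum>y\<le>9. \<Sum>x'\<le>9. \<Sum>y'\<le>9.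
      two_card_prob x * two_card_prob y * third_card_prob x' * third_card_prob y' *
      (of_bool (player_signal u x x' = k) * of_bool (y = j) * draw_change u x y x' y'))
   = (\<Sum>x\<le>9. \<Sum>y\<le>9. if y = j then two_card_prob j * (\<Sum>x'\<le>9. \<Sum>y'\<le>9.
      two_card_prob x * third_card_prob x' * third_card_prob y' *
      (of_bool (player_signal u x x' = k) * draw_change u x j x' y')) else 0)"
    by (intro sum.cong refl) (auto simp: sum_distrib_left mult_ac)
  also have "\<dots> = two_card_prob j * signal_gain u k j"
    using assms by (simp add: signal_gain_def sum_distrib_left)
  finally show ?thesis .
qed

definition pure_draw_effect :: "real \<Rightarrow> nat \<Rightarrow> nat \<Rightarrow> nat \<times> nat \<times> nat \<Rightarrow> real" where
  "pure_draw_effect \<theta> u1 u2 = (\<lambda>(k1, k2, j). two_card_prob j *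
     (\<theta> * signal_gain u1 k1 j * signal_prob u2 k2
      + (1 - \<theta>) * signal_prob u1 k1 * signal_gain u2 k2 j))"

text \<open>The two Players' hands and Banker's total are independent, so on an information set the gain from
  one Player's result is multiplied by the probability of the other Player's signal.\<close>

lemma pure_payoff_decomposition:
  assumes T: "T \<subseteq> info_sets" and u: "u1 \<le> 1" "u2 \<le> 1"
  shows "pure_payoff u1 u2 T \<theta> =
    \<theta> * stand_payoff u1 + (1 - \<theta>) * stand_payoff u2
    + (\<Sum>z\<in>T. pure_draw_effect \<theta> u1 u2 z)"
proof -
  let ?E = "measure_pmf.expectation deal_pmf"
  have fT: "finite T"
    using T finite_info_sets by (rule finite_subset)
  define S1 :: "nat \<times> nat \<times> nat \<times> nat \<times> nat \<times> nat \<Rightarrow> real" where "S1 = (\<lambda>(x1, x2, y, x1', x2', y'). stand_result u1 x1 y x1' * (1::real))"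
  define S2 :: "nat \<times> nat \<times> nat \<times> nat \<times> nat \<times> nat \<Rightarrow> real" where "S2 = (\<lambda>(x1, x2, y, x1', x2', y'). (1::real) * stand_result u2 x2 y x2')"
  define D1 where "D1 = (\<lambda>(k1, k2, j). \<lambda>(x1, x2, y, x1', x2', y').
     (of_bool (player_signal u1 x1 x1' = k1) * of_bool (y = j) * draw_change u1 x1 y x1' y')
      * of_bool (player_signal u2 x2 x2' = k2) :: real)"
  define D2 where "D2 = (\<lambda>(k1, k2, j). \<lambda>(x1, x2, y, x1', x2', y').
      of_bool (player_signal u1 x1 x1' = k1) *
      (of_bool (player_signal u2 x2 x2' = k2) * of_bool (y = j) * draw_change u2 x2 y x2' y') :: real)"
  have delta: "(\<Sum>z\<in>T. c * D1 z w + d * D2 z w) =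
      (case w of (x1, x2, y, x1', x2', y') \<Rightarrow>
        of_bool ((player_signal u1 x1 x1', player_signal u2 x2 x2', y) \<in> T) *
        (c * draw_change u1 x1 y x1' y' + d * draw_change u2 x2 y x2' y'))" for w c d
  proof (cases w)
    case (fields x1 x2 y x1' x2' y')
    let ?z = "(player_signal u1 x1 x1', player_signal u2 x2 x2', y)"
    have "(\<Sum>z\<in>T. c * D1 z w + d * D2 z w) =
      (\<Sum>z\<in>T. if z = ?z then c * draw_change u1 x1 y x1' y' + d * draw_change u2 x2 y x2' y' else 0)"
      by (intro sum.cong refl) (auto simp: fields D1_def D2_def of_bool_def split: if_splits)
    then show ?thesis
      using fT by (simp add: fields)
  qed
  have "pure_payoff u1 u2 T \<theta> =
    ?E (\<lambda>w. \<theta> * S1 w + (1 - \<theta>) * S2 w + (\<Sum>z\<in>T. \<theta> * D1 z w + (1 - \<theta>) * D2 z w))"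
    unfolding pure_payoff_def Let_def delta
    by (intro arg_cong[where f = "?E"] ext)
       (auto simp: S1_def S2_def hand_result_split[OF T u] algebra_simps)
  also have "\<dots> = \<theta> * ?E S1 + (1 - \<theta>) * ?E S2 + (\<Sum>z\<in>T. \<theta> * ?E (D1 z) + (1 - \<theta>) * ?E (D2 z))"
    by simp
  also have "?E S1 = stand_payoff u1"
    unfolding S1_def deal_expectation_factor1 by (simp add: stand_payoff_def sum_card_probs)
  also have "?E S2 = stand_payoff u2"
    unfolding S2_def deal_expectation_factor2 by (simp add: stand_payoff_def sum_card_probs)
  also have "(\<Sum>z\<in>T. \<theta> * ?E (D1 z) + (1 - \<theta>) * ?E (D2 z)) = (\<Sum>z\<in>T. pure_draw_effect \<theta> u1 u2 z)"
  proof (intro sum.cong refl)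
    fix z assume "z \<in> T"
    then obtain k1 k2 j where z: "z = (k1, k2, j)" and j: "j \<le> 9"
      using T by (auto simp: info_sets_def)
    have "?E (D1 z) = (two_card_prob j * signal_gain u1 k1 j) * signal_prob u2 k2"
      unfolding D1_def z prod.case deal_expectation_factor1 signal_gain_at_total[OF j]
      by (simp add: signal_prob_def)
    moreover have "?E (D2 z) = signal_prob u1 k1 * (two_card_prob j * signal_gain u2 k2 j)"
      unfolding D2_def z prod.case deal_expectation_factor2 signal_gain_at_total[OF j]
      by (simp add: signal_prob_def)
    ultimately show "\<theta> * ?E (D1 z) + (1 - \<theta>) * ?E (D2 z) = pure_draw_effect \<theta> u1 u2 z"
      by (simp add: z pure_draw_effect_def algebra_simps)
  qed
  finally show ?thesis .
qed

section \<open>Banker's best responses\<close>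

text \<open>Averages over a Player's decision on 5. The payoff is bilinear in the two decisions, so each
  Player's quantities can be averaged separately.\<close>

definition mix :: "real \<Rightarrow> (nat \<Rightarrow> real) \<Rightarrow> real" where
  "mix p f = (1 - p) * f 0 + p * f 1"

definition draw_effect :: "real \<Rightarrow> real \<Rightarrow> real \<Rightarrow> nat \<times> nat \<times> nat \<Rightarrow> real" where
  "draw_effect \<theta> p1 p2 = (\<lambda>(k1, k2, j). two_card_prob j *
     (\<theta> * mix p1 (\<lambda>u. signal_gain u k1 j) * mix p2 (\<lambda>u. signal_prob u k2)
      + (1 - \<theta>) * mix p1 (\<lambda>u. signal_prob u k1) * mix p2 (\<lambda>u. signal_gain u k2 j)))"

definition stand_value :: "real \<Rightarrow> real \<Rightarrow> real \<Rightarrow> real" where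
  "stand_value \<theta> p1 p2 = \<theta> * mix p1 stand_payoff + (1 - \<theta>) * mix p2 stand_payoff"

lemma draw_effect_eq_pure:
  "draw_effect \<theta> p1 p2 z =
     (1 - p1) * (1 - p2) * pure_draw_effect \<theta> 0 0 z + (1 - p1) * p2 * pure_draw_effect \<theta> 0 1 z
     + p1 * (1 - p2) * pure_draw_effect \<theta> 1 0 z + p1 * p2 * pure_draw_effect \<theta> 1 1 z"
  by (cases z) (simp add: draw_effect_def pure_draw_effect_def mix_def algebra_simps)

lemma mixed_payoff_decomposition:
  assumes "T \<subseteq> info_sets"
  shows "mixed_payoff T \<theta> p1 p2 = stand_value \<theta> p1 p2 + (\<Sum>z\<in>T. draw_effect \<theta> p1 p2 z)"
  unfolding mixed_payoff_def draw_effect_eq_pure sum.distrib sum_distrib_left [symmetric]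
  by (simp add: pure_payoff_decomposition[OF assms] stand_value_def mix_def algebra_simps)

lemma banker_indifferent_iff:
  assumes "z \<in> info_sets"
  shows "banker_indifferent \<theta> p1 p2 z \<longleftrightarrow> draw_effect \<theta> p1 p2 z = 0"
proof -
  have "mixed_payoff (insert z T) \<theta> p1 p2 - mixed_payoff (T - {z}) \<theta> p1 p2
      = draw_effect \<theta> p1 p2 z" if "T \<subseteq> info_sets" for T
  proof -
    have "finite T" "T - {z} \<subseteq> info_sets" "insert z T \<subseteq> info_sets"
      using that assms finite_subset[OF that finite_info_sets] by auto
    then show ?thesis
      by (simp add: mixed_payoff_decomposition sum.insert_remove)
  qed
  then show ?thesis
    unfolding banker_indifferent_def by (metis eq_iff_diff_eq_0 empty_subsetI)
qed

text \<open>Banker minimizes a sum in which every information set contributes its own term or nothing.\<close>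

lemma is_best_response_iff:
  "is_best_response \<theta> p1 p2 T \<longleftrightarrow> T \<subseteq> info_sets \<and>
     (\<forall>z\<in>info_sets. (draw_effect \<theta> p1 p2 z < 0 \<longrightarrow> z \<in> T) \<and> (draw_effect \<theta> p1 p2 z > 0 \<longrightarrow> z \<notin> T))"
  (is "?L \<longleftrightarrow> _ \<and> ?R")
proof (cases "T \<subseteq> info_sets")
  case T: True
  let ?d = "draw_effect \<theta> p1 p2"
  have fin: "finite S" if "S \<subseteq> info_sets" for S
    using that finite_info_sets by (rule finite_subset)
  have restrict: "sum ?d S = (\<Sum>z\<in>info_sets. if z \<in> S then ?d z else 0)" if "S \<subseteq> info_sets" for S
    using that by (simp add: sum.inter_restrict[OF finite_info_sets, symmetric] Int_absorb1)
  have L: "?L \<longleftrightarrow> (\<forall>S. S \<subseteq> info_sets \<longrightarrow> sum ?d T \<le> sum ?d S)"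
    using T by (simp add: is_best_response_def mixed_payoff_decomposition)
  show ?thesis
  proof
    assume ?L
    then have le: "sum ?d T \<le> sum ?d S" if "S \<subseteq> info_sets" for S
      using L that by blast
    have "z \<in> T" if "z \<in> info_sets" "?d z < 0" for z
    proof (rule ccontr)
      assume "z \<notin> T"
      then show False
        using le[of "insert z T"] that T fin[OF T] by simp
    qed
    moreover have "z \<notin> T" if "z \<in> info_sets" "?d z > 0" for z
    proof
      assume "z \<in> T"
      then show False
        using le[of "T - {z}"] that T fin[OF T] by (auto simp: sum_diff1)
    qed
    ultimately show "T \<subseteq> info_sets \<and> ?R"
      using T by blast
  next
    assume R: "T \<subseteq> info_sets \<and> ?R"
    have "sum ?d T \<le> sum ?d S" if S: "S \<subseteq> info_sets" for S
      unfolding restrict[OF T] restrict[OF S]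
    proof (intro sum_mono)
      fix z assume "z \<in> info_sets"
      then show "(if z \<in> T then ?d z else 0) \<le> (if z \<in> S then ?d z else 0)"
        using R by (cases "?d z" "0::real" rule: linorder_cases) auto
    qed
    then show ?L
      using L by blast
  qed
qed (simp add: is_best_response_def)

lemma security_level_le:
  "T \<subseteq> info_sets \<Longrightarrow> security_level \<theta> p1 p2 \<le> mixed_payoff T \<theta> p1 p2"
  unfolding security_level_def using finite_info_sets by (intro Min_le) auto

lemma security_level_eq:
  "is_best_response \<theta> p1 p2 T \<Longrightarrow> security_level \<theta> p1 p2 = mixed_payoff T \<theta> p1 p2"
  unfolding security_level_def is_best_response_def using finite_info_sets
  by (intro Min_eqI) auto

lemma strict_maximin:
  assumes "p1 \<in> {0..1}" "p2 \<in> {0..1}"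
    and less: "\<And>r1 r2. r1 \<in> {0..1} \<Longrightarrow> r2 \<in> {0..1} \<Longrightarrow> (r1, r2) \<noteq> (p1, p2) \<Longrightarrow>
      security_level \<theta> r1 r2 < security_level \<theta> p1 p2"
  shows "is_maximin \<theta> r1 r2 \<longleftrightarrow> r1 = p1 \<and> r2 = p2"
    and "lower_value \<theta> = security_level \<theta> p1 p2"
proof -
  have le: "security_level \<theta> r1 r2 \<le> security_level \<theta> p1 p2"
    if "r1 \<in> {0..1}" "r2 \<in> {0..1}" for r1 r2
    using less[OF that] by (cases "(r1, r2) = (p1, p2)") auto
  show "is_maximin \<theta> r1 r2 \<longleftrightarrow> r1 = p1 \<and> r2 = p2"
    using assms(1,2) le less unfolding is_maximin_def by (metis not_less prod.inject)
  show "lower_value \<theta> = security_level \<theta> p1 p2"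
    unfolding lower_value_def using assms(1,2) le by (intro cSup_eq_maximum) force+
qed

section \<open>The gains as integers over powers of 13\<close>

lemma sum_sgn_digits:
  assumes "f \<le> 9"
  shows "(\<Sum>d\<le>9. sgn (real f - real d)) = 2 * real f - 9"
proof -
  have "f \<in> {0,1,2,3,4,5,6,7,8,9}"
    using assms by auto
  then show ?thesis
    by (auto simp: eval_nat_numeral)
qed

text \<open>With equally likely digits Banker's final total would be uniform whatever his two-card total
  \<open>j\<close> is. The three additional cards of value 0 leave \<open>j\<close> unchanged, hence
  \<open>(2 * f - 9 + 3 * sgn (f - j)) / 13\<close> after drawing, against \<open>sgn (f - j)\<close> without.\<close>

lemma mean_sgn_draw:
  assumes "f \<le> 9" "j \<le> 9"
  shows "(\<Sum>y'\<le>9. third_card_prob y' * (sgn (real f - real ((j + y') mod 10)) - sgn (real f - real j)))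
    = (2 * real f - 9 - 10 * sgn (real f - real j)) / 13"
proof -
  let ?s = "\<lambda>d. sgn (real f - real d)"
  have "bij_betw (\<lambda>y'. (j + y') mod 10) {..9} {..9}"
  proof (rule bij_betw_byWitness[where f' = "\<lambda>d. (d + (10 - j)) mod 10"])
    have "((j + a) mod 10 + (10 - j)) mod 10 = (a + (j + (10 - j))) mod 10" for a
      by (subst mod_add_left_eq) (simp only: ac_simps)
    then show "\<forall>a\<in>{..9}. ((j + a) mod 10 + (10 - j)) mod 10 = a"
      using assms(2) by (simp del: add_diff_assoc2)
    have "(j + (d + (10 - j)) mod 10) mod 10 = (d + (j + (10 - j))) mod 10" for d
      by (subst mod_add_right_eq) (simp only: ac_simps)
    then show "\<forall>d\<in>{..9}. (j + (d + (10 - j)) mod 10) mod 10 = d"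
      using assms(2) by (simp del: add_diff_assoc2)
  qed auto
  then have "(\<Sum>y'\<le>9. ?s ((j + y') mod 10)) = (\<Sum>d\<le>9. ?s d)"
    by (rule sum.reindex_bij_betw [where g = ?s])
  also note sum_sgn_digits[OF assms(1)]
  finally have shift: "(\<Sum>y'\<le>9. ?s ((j + y') mod 10)) = 2 * real f - 9" .
  have "third_card_prob y' * (?s ((j + y') mod 10) - ?s j) =
     (?s ((j + y') mod 10) - ?s j) / 13" for y'
    using assms by (cases "y' = 0") (simp_all add: third_card_prob_def)
  then have "(\<Sum>y'\<le>9. third_card_prob y' * (?s ((j + y') mod 10) - ?s j)) =
    ((\<Sum>y'\<le>9. ?s ((j + y') mod 10)) - 10 * ?s j) / 13"
    by (simp add: sum_subtractf sum_divide_distrib [symmetric] diff_divide_distrib)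
  then show ?thesis
    by (simp add: shift)
qed

text \<open>The mean change of \<open>mean_sgn_draw\<close>, times 13. All quantities below are integers over powers
  of 13, so that finitely many cases can be settled by rewriting.\<close>

definition margin :: "nat \<Rightarrow> nat \<Rightarrow> int" where
  "margin f j = 2 * int f - 9 - 10 * sgn (int f - int j)"

definition two_card_num :: "nat \<Rightarrow> int" where
  "two_card_num x = (if x = 0 then 25 else 16)"

definition third_card_num :: "nat \<Rightarrow> int" where
  "third_card_num k = (if k = 0 then 4 else 1)"

text \<open>The factor \<open>third_card_num k\<close>, common to \<open>signal_gain\<close> and \<open>signal_prob\<close>, is left out; it has no
  influence on signs. The factor 13 for a standing Player makes up for the missing third card.\<close>

definition gain_num :: "nat \<Rightarrow> nat \<Rightarrow> nat \<Rightarrow> int" where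
  "gain_num u k j =
     (if k \<le> 9 then \<Sum>x\<leftarrow>[0..<5 + u]. two_card_num x * margin ((x + k) mod 10) j
      else if k = 10 then 13 * (\<Sum>x\<leftarrow>[5 + u..<8]. two_card_num x * margin x j)
      else 0)"

definition prob_num :: "nat \<Rightarrow> nat \<Rightarrow> int" where
  "prob_num u k = (if k \<le> 9 then 89 + 16 * int u else if k = 10 then 13 * (48 - 16 * int u) else 416)"

lemma two_card_prob_eq: "two_card_prob x = real_of_int (two_card_num x) / 169"
  by (simp add: two_card_prob_def two_card_num_def)

lemma third_card_prob_eq: "third_card_prob k = real_of_int (third_card_num k) / 13"
  by (simp add: third_card_prob_def third_card_num_def)

lemma sum_draw_change:
  assumes "x \<le> 9" "j \<le> 9" "u \<le> 1"
  shows "(\<Sum>y'\<le>9. third_card_prob y' * draw_change u x j x' y') =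
    (if x \<ge> 8 then 0 else real_of_int (margin (player_total u x x') j) / 13)"
proof -
  have f: "player_total u x x' \<le> 9"
    using assms by (auto simp: player_total_def)
  have "sgn (real (player_total u x x') - real j) = real_of_int (sgn (int (player_total u x x') - int j))"
    by (auto simp: sgn_if)
  then show ?thesis
    using mean_sgn_draw[OF f assms(2)] by (simp add: draw_change_def margin_def)
qed

lemma signal_gain_sum:
  assumes "j \<le> 9" "u \<le> 1"
  shows "signal_gain u k j = (\<Sum>x\<le>9. \<Sum>x'\<le>9. two_card_prob x * third_card_prob x' *
    (if player_signal u x x' = k \<and> x < 8 then real_of_int (margin (player_total u x x') j) / 13 else 0))"
  unfolding signal_gain_def
proof (intro sum.cong refl)
  fix x x' :: nat assume "x \<in> {..9}"
  then have x: "x \<le> 9" by simp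
  have "(\<Sum>y'\<le>9. two_card_prob x * third_card_prob x' * third_card_prob y' *
         (of_bool (player_signal u x x' = k) * draw_change u x j x' y')) =
    two_card_prob x * third_card_prob x' * of_bool (player_signal u x x' = k) *
     (\<Sum>y'\<le>9. third_card_prob y' * draw_change u x j x' y')"
    by (simp add: sum_distrib_left mult_ac)
  then show "(\<Sum>y'\<le>9. two_card_prob x * third_card_prob x' * third_card_prob y' *
         (of_bool (player_signal u x x' = k) * draw_change u x j x' y')) =
       two_card_prob x * third_card_prob x' *
       (if player_signal u x x' = k \<and> x < 8 then real_of_int (margin (player_total u x x') j) / 13 else 0)"
    using x by (simp add: sum_draw_change[OF x assms])
qed

lemma sum_two_card_totals:
  fixes g :: "nat \<Rightarrow> nat \<Rightarrow> real"
  assumes "u \<le> 1"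
  shows "(\<Sum>x\<le>9. \<Sum>x'\<le>9. g x x') =
    (\<Sum>x=0..<5+u. \<Sum>x'\<le>9. g x x') + (\<Sum>x=5+u..<8. \<Sum>x'\<le>9. g x x') + (\<Sum>x=8..<10. \<Sum>x'\<le>9. g x x')"
proof -
  have "{..9} = {0..<10::nat}"
    by auto
  then show ?thesis
    using assms by (simp add: sum.atLeastLessThan_concat)
qed

lemma signal_gain_eq_num:
  assumes "j \<le> 9" "u \<le> 1" "k \<le> 11"
  shows "signal_gain u k j = real_of_int (third_card_num k * gain_num u k j) / 13 ^ 4"
proof -
  have lists: "(\<Sum>x\<leftarrow>[a..<b]. h x) = (\<Sum>x\<in>{a..<b}. h x :: int)" for a b h
    by (simp add: sum_list_distinct_conv_sum_set)
  define G where "G x x' = real_of_int (margin (player_total u x x') j) / 13" for x x'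
  have split: "signal_gain u k j =
    (\<Sum>x\<in>{0..<5+u}. \<Sum>x'\<le>9. two_card_prob x * third_card_prob x' * (if x' = k then G x x' else 0)) +
    (\<Sum>x\<in>{5+u..<8}. \<Sum>x'\<le>9. two_card_prob x * third_card_prob x' * (if k = 10 then G x x' else 0))"
  proof -
    show ?thesis
      unfolding signal_gain_sum[OF assms(1,2)] G_def[symmetric] sum_two_card_totals[OF assms(2)]
      using assms(2) by (auto simp: player_signal_def intro!: arg_cong2[where f = "(+)"] sum.cong)
  qed
  consider "k \<le> 9" | "k = 10" | "k = 11"
    using assms(3) by linarith
  then show ?thesis
  proof cases
    case 1
    have "signal_gain u k j = (\<Sum>x\<in>{0..<5+u}. two_card_prob x * third_card_prob k * G x k)"
      unfolding split using 1 by (simp add: mult_delta_right)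
    also have "\<dots> = (\<Sum>x\<in>{0..<5+u}. real_of_int (third_card_num k * (two_card_num x * margin ((x + k) mod 10) j)) / 13^4)"
      by (intro sum.cong refl) (simp add: two_card_prob_eq third_card_prob_eq G_def player_total_def)
    finally show ?thesis
      using 1 by (simp add: gain_num_def lists sum_divide_distrib sum_distrib_left)
  next
    case 2
    have "signal_gain u k j = (\<Sum>x\<in>{5+u..<8}. \<Sum>x'\<le>9. third_card_prob x' * (two_card_prob x * (real_of_int (margin x j) / 13)))"
      unfolding split using 2
      by (auto simp: G_def player_total_def intro!: sum.cong)
    also have "\<dots> = (\<Sum>x\<in>{5+u..<8}. two_card_prob x * (real_of_int (margin x j) / 13))"
      by (simp only: sum_distrib_right [symmetric] sum_third_card_prob mult_1_left)
    also have "\<dots> = (\<Sum>x\<in>{5+u..<8}. real_of_int (13 * (two_card_num x * margin x j)) / 13^4)"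
      by (intro sum.cong refl) (simp add: two_card_prob_eq)
    finally show ?thesis
      using 2 by (simp add: gain_num_def third_card_num_def lists sum_divide_distrib sum_distrib_left)
  next
    case 3
    then show ?thesis
      unfolding split by (simp add: gain_num_def)
  qed
qed

lemma signal_prob_eq_num:
  assumes "u \<le> 1" "k \<le> 11"
  shows "signal_prob u k = real_of_int (third_card_num k * prob_num u k) / 13 ^ 3"
proof -
  have "(\<Sum>x=0..<5+u. two_card_prob x) = (89 + 16 * real u) / 169"
    "(\<Sum>x=5+u..<8. two_card_prob x) = (48 - 16 * real u) / 169"
    "(\<Sum>x=8..<10. two_card_prob x) = 32 / 169"
    using assms(1) by (auto simp: le_Suc_eq two_card_prob_def eval_nat_numeral)
  moreover have "signal_prob u k =
    (\<Sum>x=0..<5+u. two_card_prob x) * (if k \<le> 9 then third_card_prob k else 0) +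
    (\<Sum>x=5+u..<8. two_card_prob x) * (if k = 10 then 1 else 0) +
    (\<Sum>x=8..<10. two_card_prob x) * (if k = 11 then 1 else 0)"
  proof -
    have A: "x < 5 + u \<Longrightarrow> (\<Sum>x'\<le>9. two_card_prob x * third_card_prob x' * of_bool (player_signal u x x' = k))
        = two_card_prob x * (if k \<le> 9 then third_card_prob k else 0)" for x
      by (simp add: player_signal_def of_bool_def mult_delta_right)
    have B: "\<lbrakk>5 + u \<le> x; x < 8\<rbrakk> \<Longrightarrow> (\<Sum>x'\<le>9. two_card_prob x * third_card_prob x' * of_bool (player_signal u x x' = k))
        = two_card_prob x * (if k = 10 then 1 else 0)" for x
      by (simp add: player_signal_def sum_distrib_left[symmetric] sum_third_card_prob)
    have C: "8 \<le> x \<Longrightarrow> (\<Sum>x'\<le>9. two_card_prob x * third_card_prob x' * of_bool (player_signal u x x' = k))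
        = two_card_prob x * (if k = 11 then 1 else 0)" for x
      using assms(1) by (simp add: player_signal_def sum_distrib_left[symmetric] sum_third_card_prob)
    show ?thesis
      unfolding signal_prob_def sum_two_card_totals[OF assms(1)] sum_distrib_right
      using A B C by (intro arg_cong2[where f = "(+)"] sum.cong refl) auto
  qed
  ultimately show ?thesis
    using assms(2) by (auto simp: prob_num_def third_card_num_def third_card_prob_def)
qed

definition stand_num :: "nat \<Rightarrow> int" where
  "stand_num u = (\<Sum>x\<leftarrow>[0..<10]. \<Sum>y\<leftarrow>[0..<10]. \<Sum>x'\<leftarrow>[0..<10].
     two_card_num x * two_card_num y * third_card_num x' *
     (if x \<ge> 8 \<or> y \<ge> 8 then sgn (int x - int y) else sgn (int (player_total u x x') - int y)))"

lemma stand_payoff_eq_num: "stand_payoff u = real_of_int (stand_num u) / 13 ^ 5"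
proof -
  have digits: "{..9} = set [0..<10::nat]"
    by auto
  have lists: "sum h {..9} = (\<Sum>x\<leftarrow>[0..<10]. h x)" for h :: "nat \<Rightarrow> real"
    unfolding digits by (simp only: sum_list_distinct_conv_sum_set distinct_upt)
  have push: "real_of_int (\<Sum>x\<leftarrow>xs. h x) = (\<Sum>x\<leftarrow>xs. real_of_int (h x))" for h and xs :: "nat list"
    by (induction xs) auto
  have divide: "(\<Sum>x\<leftarrow>xs. h x) / c = (\<Sum>x\<leftarrow>xs. h x / c)" for h and xs :: "nat list" and c :: real
    by (induction xs) (auto simp: add_divide_distrib)
  have sgn: "sgn (real a - real b) = real_of_int (sgn (int a - int b))" for a b
    by (auto simp: sgn_if)
  have "stand_payoff u = (\<Sum>x\<le>9. \<Sum>y\<le>9. \<Sum>x'\<le>9.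
      (two_card_prob x * two_card_prob y * third_card_prob x' * stand_result u x y x')
       * (\<Sum>y'\<le>9. third_card_prob y'))"
    unfolding stand_payoff_def sum_distrib_left by (intro sum.cong refl) (simp add: mult_ac)
  also have "\<dots> = (\<Sum>x\<leftarrow>[0..<10]. \<Sum>y\<leftarrow>[0..<10]. \<Sum>x'\<leftarrow>[0..<10].
      two_card_prob x * two_card_prob y * third_card_prob x' * stand_result u x y x')"
    unfolding sum_third_card_prob mult_1_right unfolding lists ..
  also have "\<dots> = real_of_int (stand_num u) / 13 ^ 5"
    unfolding stand_num_def push divide
    by (intro arg_cong[where f = sum_list] map_cong refl)
       (simp add: stand_result_def two_card_prob_eq third_card_prob_eq sgn)
  finally show ?thesis .
qed

lemma stand_num_values: "stand_num 0 = 72713 \<and> stand_num 1 = 68985"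
  by code_simp

section \<open>Signs of the effects of drawing\<close>

definition gain_at :: "real \<Rightarrow> nat \<Rightarrow> nat \<Rightarrow> real" where
  "gain_at p k j = mix p (\<lambda>u. real_of_int (gain_num u k j))"

definition prob_at :: "real \<Rightarrow> nat \<Rightarrow> real" where
  "prob_at p k = mix p (\<lambda>u. real_of_int (prob_num u k))"

lemma draw_effect_eq_num:
  assumes "k1 \<le> 11" "k2 \<le> 11" "j \<le> 7"
  shows "draw_effect \<theta> p1 p2 (k1, k2, j) =
    real_of_int (two_card_num j * third_card_num k1 * third_card_num k2) / 13 ^ 9 *
    (\<theta> * gain_at p1 k1 j * prob_at p2 k2 + (1 - \<theta>) * prob_at p1 k1 * gain_at p2 k2 j)"
proof -
  have gain: "mix p (\<lambda>u. signal_gain u k j) = real_of_int (third_card_num k) * gain_at p k j / 13 ^ 4"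
    and prob: "mix p (\<lambda>u. signal_prob u k) = real_of_int (third_card_num k) * prob_at p k / 13 ^ 3"
    if "k \<le> 11" for p k
    using that assms(3)
    by (simp_all add: mix_def gain_at_def prob_at_def signal_gain_eq_num signal_prob_eq_num
        add_divide_distrib diff_divide_distrib algebra_simps)
  show ?thesis
    by (simp add: draw_effect_def two_card_prob_eq gain[OF assms(1)] gain[OF assms(2)]
        prob[OF assms(1)] prob[OF assms(2)])
       (simp add: field_simps)
qed

text \<open>Row \<open>k\<close>, column \<open>j\<close>: integers between which 10000 times the conditional mean gain
  \<open>gain_at p k j / prob_at p k\<close> lies for \<open>0.787 \<le> p \<le> 0.789\<close>. The precision is dictated by the
  information sets \<open>(2, 5, 5)\<close> and \<open>(9, 3, 4)\<close>, whose signs change for \<open>\<theta>\<close> slightly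
  below 0.496.\<close>

definition rate_bounds :: "(int \<times> int) list list" where
  "rate_bounds =
    [[(-121499, -121488), (-81144, -81141), (-49656, -49642), (-18167, -18143), (13322, 13355), (41488, 41499), (53893, 53911), (53893, 53911)],
     [(-126107, -126089), (-101499, -101488), (-61144, -61141), (-29656, -29642), (1833, 1857), (33322, 33355), (61488, 61499), (73893, 73911)],
     [(-106107, -106089), (-106107, -106089), (-81499, -81488), (-41144, -41141), (-9656, -9642), (21833, 21857), (53322, 53355), (81488, 81499)],
     [(-86107, -86089), (-86107, -86089), (-86107, -86089), (-61499, -61488), (-21144, -21141), (10344, 10358), (41833, 41857), (73322, 73355)],
     [(-66107, -66089), (-66107, -66089), (-66107, -66089), (-66107, -66089), (-41499, -41488), (-1144, -1141), (30344, 30358), (61833, 61857)],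
     [(-58512, -58501), (-46107, -46089), (-46107, -46089), (-46107, -46089), (-46107, -46089), (-21499, -21488), (18856, 18859), (50344, 50358)],
     [(-66678, -66645), (-38512, -38501), (-26107, -26089), (-26107, -26089), (-26107, -26089), (-26107, -26089), (-1499, -1488), (38856, 38859)],
     [(-78167, -78143), (-46678, -46645), (-18512, -18501), (-6107, -6089), (-6107, -6089), (-6107, -6089), (-6107, -6089), (18501, 18512)],
     [(-89656, -89642), (-58167, -58143), (-26678, -26645), (1488, 1499), (13893, 13911), (13893, 13911), (13893, 13911), (13893, 13911)],
     [(-101144, -101141), (-69656, -69642), (-38167, -38143), (-6678, -6645), (21488, 21499), (33893, 33911), (33893, 33911), (33893, 33911)],
     [(-62888, -62862), (-62888, -62862), (-62888, -62862), (-62888, -62862), (-62888, -62862), (-53320, -53262), (1451, 1550), (91908, 91925)],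
     [(0, 0), (0, 0), (0, 0), (0, 0), (0, 0), (0, 0), (0, 0), (0, 0)]]"

text \<open>The bounds are affine in \<open>p\<close> after multiplication by \<open>prob_at p k\<close>, so the end points of the
  interval suffice.\<close>

definition rate_bounds_ok :: "nat \<Rightarrow> nat \<Rightarrow> bool" where
  "rate_bounds_ok k j =
     (case rate_bounds ! k ! j of (lo, hi) \<Rightarrow>
        case (gain_num 0 k j, gain_num 1 k j, prob_num 0 k, prob_num 1 k) of (g0, g1, b0, b1) \<Rightarrow>
        lo * (213 * b0 + 787 * b1) \<le> 10000 * (213 * g0 + 787 * g1) \<and>
        lo * (211 * b0 + 789 * b1) \<le> 10000 * (211 * g0 + 789 * g1) \<and>
        10000 * (213 * g0 + 787 * g1) \<le> hi * (213 * b0 + 787 * b1) \<and>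
        10000 * (211 * g0 + 789 * g1) \<le> hi * (211 * b0 + 789 * b1))"

lemma all_rate_bounds_ok: "\<forall>k\<in>set [0..<12]. \<forall>j\<in>set [0..<8]. rate_bounds_ok k j"
  by code_simp

lemma mix_nonneg:
  fixes h :: "nat \<Rightarrow> int"
  assumes "p \<in> {787/1000..789/1000}" "0 \<le> 213 * h 0 + 787 * h 1" "0 \<le> 211 * h 0 + 789 * h 1"
  shows "0 \<le> mix p (\<lambda>u. real_of_int (h u))"
proof -
  have "2 * mix p (\<lambda>u. real_of_int (h u)) =
      (789/1000 - p) * real_of_int (213 * h 0 + 787 * h 1)
      + (p - 787/1000) * real_of_int (211 * h 0 + 789 * h 1)"
    by (simp add: mix_def algebra_simps)
  also have "\<dots> \<ge> 0"
    using assms(1)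
    by (intro add_nonneg_nonneg mult_nonneg_nonneg [OF _ of_int_nonneg [OF assms(2)]]
        mult_nonneg_nonneg [OF _ of_int_nonneg [OF assms(3)]]) auto
  finally show ?thesis by simp
qed

lemma prob_at_pos:
  assumes "p \<in> {787/1000..789/1000}"
  shows "prob_at p k > 0"
  using assms by (auto simp: prob_at_def mix_def prob_num_def algebra_simps)

lemma rate_bounds:
  assumes p: "p \<in> {787/1000..789/1000}" and k: "k \<le> 11" "j \<le> 7"
    and lohi: "rate_bounds ! k ! j = (lo, hi)"
  shows "real_of_int lo * prob_at p k \<le> 10000 * gain_at p k j"
    and "10000 * gain_at p k j \<le> real_of_int hi * prob_at p k"
proof -
  have "rate_bounds_ok k j"
    using all_rate_bounds_ok k by auto
  note * = this[unfolded rate_bounds_ok_def lohi prod.case]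
  let ?g = "\<lambda>u. gain_num u k j" and ?b = "\<lambda>u. prob_num u k"
  have "mix p (\<lambda>u. real_of_int (10000 * ?g u - lo * ?b u)) \<ge> 0"
    "mix p (\<lambda>u. real_of_int (hi * ?b u - 10000 * ?g u)) \<ge> 0"
    by (rule mix_nonneg[OF p]; use * in \<open>simp add: algebra_simps\<close>)+
  then show "real_of_int lo * prob_at p k \<le> 10000 * gain_at p k j"
    and "10000 * gain_at p k j \<le> real_of_int hi * prob_at p k"
    by (simp_all add: mix_def gain_at_def prob_at_def algebra_simps)
qed

text \<open>Here the end points are those of the interval for \<open>\<theta>\<close>.\<close>

definition advice_ok :: "nat \<Rightarrow> nat \<Rightarrow> nat \<Rightarrow> bool" where
  "advice_ok k1 k2 j =
     (case (rate_bounds ! k1 ! j, rate_bounds ! k2 ! j) of ((lo1, hi1), (lo2, hi2)) \<Rightarrow>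
        (case entry_advice (banker_table ! k1 ! k2) j of
          Draw \<Rightarrow> 4962 * hi1 + 5038 * hi2 < 0 \<and> hi1 + hi2 < 0
        | Stand \<Rightarrow> 0 < 4962 * lo1 + 5038 * lo2 \<and> 0 < lo1 + lo2
        | Draw_Or_Stand \<Rightarrow> (k1, k2) = (11, 11) \<or> (k1, k2, j) = (6, 10, 6) \<or> (k1, k2, j) = (10, 6, 6)))"

lemma all_advice_ok: "\<forall>k1\<in>set [0..<12]. \<forall>k2\<in>set [0..<12]. \<forall>j\<in>set [0..<8]. advice_ok k1 k2 j"
  by code_simp

lemma draw_effect_sign:
  assumes \<theta>: "\<theta> \<in> {4962/10000..1/2}"
    and p1: "p1 \<in> {787/1000..789/1000}" and p2: "p2 \<in> {787/1000..789/1000}"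
    and z: "(k1, k2, j) \<in> info_sets"
  shows "case entry_advice (banker_table ! k1 ! k2) j of
      Draw \<Rightarrow> draw_effect \<theta> p1 p2 (k1, k2, j) < 0
    | Stand \<Rightarrow> draw_effect \<theta> p1 p2 (k1, k2, j) > 0
    | Draw_Or_Stand \<Rightarrow> (k1, k2, j) \<in> {(6, 10, 6), (10, 6, 6)}"
proof -
  have k: "k1 \<le> 11" "k2 \<le> 11" "j \<le> 7" and not_both: "(k1, k2) \<noteq> (11, 11)"
    using z by (auto simp: info_sets_def)
  obtain lo1 hi1 lo2 hi2 where r: "rate_bounds ! k1 ! j = (lo1, hi1)" "rate_bounds ! k2 ! j = (lo2, hi2)"
    by (metis surj_pair)
  have "advice_ok k1 k2 j"
    using all_advice_ok k by auto
  note ok = this[unfolded advice_ok_def r prod.case]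
  define P1 P2 G1 G2 where "P1 = prob_at p1 k1" and "P2 = prob_at p2 k2"
    and "G1 = gain_at p1 k1 j" and "G2 = gain_at p2 k2 j"
  have P: "P1 > 0" "P2 > 0"
    using prob_at_pos p1 p2 by (auto simp: P1_def P2_def)
  have lower: "real_of_int lo1 * P1 \<le> 10000 * G1" "real_of_int lo2 * P2 \<le> 10000 * G2"
    and upper: "10000 * G1 \<le> real_of_int hi1 * P1" "10000 * G2 \<le> real_of_int hi2 * P2"
    using rate_bounds[OF p1 k(1,3) r(1)] rate_bounds[OF p2 k(2,3) r(2)]
    by (simp_all add: P1_def P2_def G1_def G2_def)
  define V where "V = \<theta> * G1 * P2 + (1 - \<theta>) * P1 * G2"
  have num: "two_card_num j > 0" "third_card_num k1 > 0" "third_card_num k2 > 0"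
    by (auto simp: two_card_num_def third_card_num_def)
  define c where "c = real_of_int (two_card_num j * third_card_num k1 * third_card_num k2) / 13 ^ 9"
  have c: "c > 0"
    using num by (simp add: c_def)
  have eff: "draw_effect \<theta> p1 p2 (k1, k2, j) = c * V"
    by (simp add: draw_effect_eq_num[OF k] V_def c_def P1_def P2_def G1_def G2_def)
  have weigh: "\<theta> * a + (1 - \<theta>) * b > 0"
    if "0 < 4962 * a + 5038 * b" "0 < a + b" for a b :: real
  proof -
    have "\<theta> * a + (1 - \<theta>) * b =
      ((1/2 - \<theta>) * (4962 * a + 5038 * b) + (\<theta> - 4962/10000) * 5000 * (a + b)) / 38"
      by (simp add: field_simps)
    moreover have "(1/2 - \<theta>) * (4962 * a + 5038 * b) + (\<theta> - 4962/10000) * 5000 * (a + b) > 0"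
    proof (cases "\<theta> = 1/2")
      case False
      then show ?thesis
        using \<theta> by (intro add_pos_nonneg mult_pos_pos [OF _ that(1)]
            mult_nonneg_nonneg [OF _ less_imp_le [OF that(2)]]) auto
    next
      case True
      show ?thesis
        unfolding True using that by simp
    qed
    ultimately show ?thesis by simp
  qed
  show ?thesis
  proof (cases "entry_advice (banker_table ! k1 ! k2) j")
    case Draw
    then have "\<theta> * real_of_int hi1 + (1 - \<theta>) * real_of_int hi2 < 0"
      using ok weigh[of "- real_of_int hi1" "- real_of_int hi2"] by simp
    then have "P1 * P2 * (\<theta> * real_of_int hi1 + (1 - \<theta>) * real_of_int hi2) < 0"
      using P by (simp add: mult_less_0_iff)
    moreover have "10000 * V \<le> P1 * P2 * (\<theta> * real_of_int hi1 + (1 - \<theta>) * real_of_int hi2)"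
    proof -
      have "\<theta> * P2 * (10000 * G1) \<le> \<theta> * P2 * (real_of_int hi1 * P1)"
        "(1 - \<theta>) * P1 * (10000 * G2) \<le> (1 - \<theta>) * P1 * (real_of_int hi2 * P2)"
        using upper P \<theta> by (intro mult_left_mono; simp)+
      then show ?thesis
        by (simp add: V_def algebra_simps)
    qed
    ultimately have "V < 0" by simp
    then show ?thesis
      using Draw c by (simp add: eff mult_less_0_iff)
  next
    case Stand
    then have "\<theta> * real_of_int lo1 + (1 - \<theta>) * real_of_int lo2 > 0"
      using ok weigh[of "real_of_int lo1" "real_of_int lo2"] by simp
    then have "P1 * P2 * (\<theta> * real_of_int lo1 + (1 - \<theta>) * real_of_int lo2) > 0"
      using P by (simp add: zero_less_mult_iff)
    moreover have "10000 * V \<ge> P1 * P2 * (\<theta> * real_of_int lo1 + (1 - \<theta>) * real_of_int lo2)"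
    proof -
      have "\<theta> * P2 * (10000 * G1) \<ge> \<theta> * P2 * (real_of_int lo1 * P1)"
        "(1 - \<theta>) * P1 * (10000 * G2) \<ge> (1 - \<theta>) * P1 * (real_of_int lo2 * P2)"
        using lower P \<theta> by (intro mult_left_mono; simp)+
      then show ?thesis
        by (simp add: V_def algebra_simps)
    qed
    ultimately have "V > 0" by simp
    then show ?thesis
      using Stand c by (simp add: eff zero_less_mult_iff)
  next
    case Draw_Or_Stand
    then show ?thesis
      using ok not_both by auto
  qed
qed

section \<open>The payoff of the tabulated strategy\<close>

text \<open>The tabulated strategy that stands where Banker is indifferent.\<close>

definition table_draws :: "(nat \<times> nat \<times> nat) set" where
  "table_draws = {(k1, k2, j). (k1, k2, j) \<in> info_sets \<and> entry_advice (banker_table ! k1 ! k2) j = Draw}"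

text \<open>Summing over \<open>k2\<close> innermost evaluates each \<open>gain_num\<close> only once. The gains from Player 2's result
  need no second computation because the table is symmetric.\<close>

definition table_gain_num :: "nat \<Rightarrow> nat \<Rightarrow> int" where
  "table_gain_num u1 u2 = (\<Sum>k1\<leftarrow>[0..<12]. \<Sum>j\<leftarrow>[0..<8].
     two_card_num j * third_card_num k1 * gain_num u1 k1 j *
     (\<Sum>k2\<leftarrow>[0..<12]. if entry_advice (banker_table ! k1 ! k2) j = Draw
        then third_card_num k2 * prob_num u2 k2 else 0))"

lemma table_gain_num_values:
  "table_gain_num 0 0 = - 2171278521" "table_gain_num 0 1 = - 2181293753"
  "table_gain_num 1 0 = - 2051682489" "table_gain_num 1 1 = - 2061652665"
  by code_simp+

lemma banker_table_sym: "\<forall>k1\<in>set [0..<12]. \<forall>k2\<in>set [0..<12]. banker_table ! k1 ! k2 = banker_table ! k2 ! k1"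
  by code_simp

lemma table_draws_eq:
  "table_draws = (\<lambda>(k1, j, k2). (k1, k2, j)) `
     {(k1, j, k2) \<in> {0..<12} \<times> {0..<8} \<times> {0..<12}. entry_advice (banker_table ! k1 ! k2) j = Draw}"
proof -
  have "banker_table ! 11 ! 11 = No_Entry"
    by (simp add: banker_table_def)
  then show ?thesis
    by (force simp: table_draws_def info_sets_def image_iff)
qed

lemma sum_table_draws:
  fixes h :: "nat \<Rightarrow> nat \<Rightarrow> nat \<Rightarrow> int"
  shows "(\<Sum>(k1, k2, j)\<in>table_draws. h k1 k2 j) =
    (\<Sum>k1\<leftarrow>[0..<12]. \<Sum>j\<leftarrow>[0..<8]. \<Sum>k2\<leftarrow>[0..<12].
       if entry_advice (banker_table ! k1 ! k2) j = Draw then h k1 k2 j else 0)"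
proof -
  let ?A = "{0..<12} \<times> {0..<8} \<times> {0..<12::nat} :: (nat \<times> nat \<times> nat) set"
  have "(\<Sum>(k1, k2, j)\<in>table_draws. h k1 k2 j) =
    (\<Sum>(k1, j, k2)\<in>{(k1, j, k2) \<in> ?A. entry_advice (banker_table ! k1 ! k2) j = Draw}. h k1 k2 j)"
    unfolding table_draws_eq by (subst sum.reindex) (auto simp: inj_on_def intro!: sum.cong)
  also have "\<dots> = (\<Sum>(k1, j, k2)\<in>?A. if entry_advice (banker_table ! k1 ! k2) j = Draw then h k1 k2 j else 0)"
    by (rule sum.mono_neutral_cong_left) (auto split: if_splits)
  finally show ?thesis
    by (simp only: sum.cartesian_product' prod.case sum_list_distinct_conv_sum_set distinct_upt
        set_upt)
qed

lemma sum_gain_prob: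
  "(\<Sum>(k1, k2, j)\<in>table_draws. two_card_num j * third_card_num k1 * third_card_num k2 *
      gain_num u1 k1 j * prob_num u2 k2) = table_gain_num u1 u2"
proof -
  have push: "c * (\<Sum>k\<leftarrow>xs. h k) = (\<Sum>k\<leftarrow>xs. c * h k)" for c :: int and h and xs :: "nat list"
    by (induction xs) (auto simp: algebra_simps)
  show ?thesis
    unfolding sum_table_draws table_gain_num_def push
    by (intro arg_cong[where f = sum_list] map_cong refl) (auto simp: mult_ac)
qed

lemma sum_prob_gain:
  "(\<Sum>(k1, k2, j)\<in>table_draws. two_card_num j * third_card_num k1 * third_card_num k2 *
      prob_num u1 k1 * gain_num u2 k2 j) = table_gain_num u2 u1"
proof -
  have "table_draws = (\<lambda>(k1, k2, j). (k2, k1, j)) ` table_draws"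
  proof -
    have "(k2, k1, j) \<in> table_draws" if "(k1, k2, j) \<in> table_draws" for k1 k2 j
      using that banker_table_sym by (force simp: table_draws_def info_sets_def)
    then show ?thesis
      by (force simp: image_iff)
  qed
  then have "(\<Sum>(k1, k2, j)\<in>table_draws. two_card_num j * third_card_num k1 * third_card_num k2 *
      prob_num u1 k1 * gain_num u2 k2 j) =
    (\<Sum>(k1, k2, j)\<in>(\<lambda>(k1, k2, j). (k2, k1, j)) ` table_draws.
      two_card_num j * third_card_num k1 * third_card_num k2 * prob_num u1 k1 * gain_num u2 k2 j)"
    by simp
  also have "\<dots> = (\<Sum>(k1, k2, j)\<in>table_draws. two_card_num j * third_card_num k1 * third_card_num k2 *
      gain_num u2 k1 j * prob_num u1 k2)"
    by (subst sum.reindex) (auto simp: inj_on_def mult_ac intro!: sum.cong)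
  finally show ?thesis
    by (simp only: sum_gain_prob)
qed

lemma sum_pure_draw_effect_table:
  assumes u: "u1 \<le> 1" "u2 \<le> 1"
  shows "(\<Sum>z\<in>table_draws. pure_draw_effect \<theta> u1 u2 z) =
    (\<theta> * real_of_int (table_gain_num u1 u2) + (1 - \<theta>) * real_of_int (table_gain_num u2 u1)) / 13 ^ 9"
proof -
  define GP where "GP = (\<lambda>(k1, k2, j). two_card_num j * third_card_num k1 * third_card_num k2 *
      gain_num u1 k1 j * prob_num u2 k2)"
  define PG where "PG = (\<lambda>(k1, k2, j). two_card_num j * third_card_num k1 * third_card_num k2 *
      prob_num u1 k1 * gain_num u2 k2 j)"
  have "(\<Sum>z\<in>table_draws. pure_draw_effect \<theta> u1 u2 z) =
      (\<Sum>z\<in>table_draws. (\<theta> * real_of_int (GP z) + (1 - \<theta>) * real_of_int (PG z)) / 13 ^ 9)"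
  proof (intro sum.cong refl)
    fix z assume "z \<in> table_draws"
    then obtain k1 k2 j where z: "z = (k1, k2, j)" and k: "k1 \<le> 11" "k2 \<le> 11" "j \<le> 9"
      by (auto simp: table_draws_def info_sets_def)
    show "pure_draw_effect \<theta> u1 u2 z = (\<theta> * real_of_int (GP z) + (1 - \<theta>) * real_of_int (PG z)) / 13 ^ 9"
      using u k by (simp add: z pure_draw_effect_def GP_def PG_def signal_gain_eq_num
          signal_prob_eq_num two_card_prob_eq) (simp add: field_simps)
  qed
  also have "\<dots> = (\<theta> * real_of_int (sum GP table_draws) + (1 - \<theta>) * real_of_int (sum PG table_draws)) / 13 ^ 9"
    by (simp only: sum_divide_distrib [symmetric] sum.distrib sum_distrib_left [symmetric] of_int_sum)
  finally show ?thesis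
    by (simp only: GP_def PG_def sum_gain_prob sum_prob_gain)
qed

lemma table_draws_subset: "table_draws \<subseteq> info_sets"
  by (auto simp: table_draws_def)

text \<open>The payoff of the tabulated strategy and the effects of drawing at the two doubtful information
  sets, all multiplied by \<open>13 ^ 9\<close>.\<close>

definition table_payoff :: "real \<Rightarrow> real \<Rightarrow> real \<Rightarrow> real" where
  "table_payoff \<theta> p1 p2 = - 94522528 + (23135856 * \<theta> - 10015232) * p1
     + (13120624 - 23135856 * \<theta>) * p2 + 45056 * p1 * p2"

definition effect_A :: "real \<Rightarrow> real \<Rightarrow> real \<Rightarrow> real" where
  "effect_A \<theta> p1 p2 = 2665728 - 3194880 * \<theta> + 479232 * p1
     + (3434496 * \<theta> - 3258112) * p2 + (425984 * \<theta> - 585728) * p1 * p2"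

definition effect_B :: "real \<Rightarrow> real \<Rightarrow> real \<Rightarrow> real" where
  "effect_B \<theta> p1 p2 = 3194880 * \<theta> - 529152 + (176384 - 3434496 * \<theta>) * p1
     + 479232 * p2 - (159744 + 425984 * \<theta>) * p1 * p2"

lemma mixed_payoff_table:
  "mixed_payoff table_draws \<theta> p1 p2 = table_payoff \<theta> p1 p2 / 13 ^ 9"
  unfolding mixed_payoff_def
  by (simp add: pure_payoff_decomposition[OF table_draws_subset] sum_pure_draw_effect_table
      stand_payoff_eq_num stand_num_values table_gain_num_values del: One_nat_def)
     (simp add: table_payoff_def field_simps)

lemma draw_effect_A: "draw_effect \<theta> p1 p2 (6, 10, 6) = effect_A \<theta> p1 p2 / 13 ^ 9"
  and draw_effect_B: "draw_effect \<theta> p1 p2 (10, 6, 6) = effect_B \<theta> p1 p2 / 13 ^ 9"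
proof -
  have "gain_num 0 6 6 = - 53 \<and> gain_num 1 6 6 = - 5 \<and> gain_num 0 10 6 = 1872 \<and> gain_num 1 10 6 = - 416"
    by code_simp
  then have "gain_at p 6 6 = 48 * p - 53" "gain_at p 10 6 = 1872 - 2288 * p"
    "prob_at p 6 = 89 + 16 * p" "prob_at p 10 = 624 - 208 * p" for p
    by (simp_all add: gain_at_def prob_at_def mix_def prob_num_def algebra_simps)
  then show "draw_effect \<theta> p1 p2 (6, 10, 6) = effect_A \<theta> p1 p2 / 13 ^ 9"
    and "draw_effect \<theta> p1 p2 (10, 6, 6) = effect_B \<theta> p1 p2 / 13 ^ 9"
    by (simp_all add: draw_effect_eq_num two_card_num_def third_card_num_def effect_A_def effect_B_def)
       (simp_all add: algebra_simps)
qed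

section \<open>The equalizing strategies of the Players\<close>

definition s_rad :: "real \<Rightarrow> real" where
  "s_rad \<theta> = (20687 - 1065024 * \<theta> * (1 - \<theta>)) * (20687 - 1556544 * \<theta> * (1 - \<theta>))"

text \<open>The Players' optimal probabilities have the form \<open>(\<alpha> - s) / D1\<close> and \<open>(\<beta> + s) / D2\<close>. This turns
  a bilinear function of them into one that is linear in the square root \<open>s\<close>, with polynomials
  in \<open>\<theta>\<close> as coefficients, so that identities can be checked by expanding.\<close>

lemma bilinear_at_critical_point:
  fixes c0 c1 c2 c3 a b s D1 D2 \<alpha> \<beta> R :: real
  assumes "a * D1 = \<alpha> - s" "b * D2 = \<beta> + s" "s\<^sup>2 = R"
  shows "D1 * D2 * (c0 + c1 * a + c2 * b + c3 * a * b) =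
    c0 * D1 * D2 + c1 * D2 * \<alpha> + c2 * D1 * \<beta> + c3 * (\<alpha> * \<beta> - R)
    + (c2 * D1 - c1 * D2 + c3 * (\<alpha> - \<beta>)) * s"
proof -
  have "D1 * D2 * (c0 + c1 * a + c2 * b + c3 * a * b) =
    c0 * D1 * D2 + c1 * D2 * (a * D1) + c2 * D1 * (b * D2) + c3 * ((a * D1) * (b * D2))"
    by (simp add: algebra_simps)
  also have "\<dots> = c0 * D1 * D2 + c1 * D2 * (\<alpha> - s) + c2 * D1 * (\<beta> + s) + c3 * ((\<alpha> - s) * (\<beta> + s))"
    by (simp only: assms(1,2))
  also have "\<dots> = c0 * D1 * D2 + c1 * D2 * \<alpha> + c2 * D1 * \<beta> + c3 * (\<alpha> * \<beta> - s\<^sup>2)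
    + (c2 * D1 - c1 * D2 + c3 * (\<alpha> - \<beta>)) * s"
    by (simp add: algebra_simps power2_eq_square)
  finally show ?thesis
    by (simp only: assms(3))
qed

locale equalizing =
  fixes \<theta> s a b :: real
  assumes \<theta>: "4962/10000 \<le> \<theta>" "\<theta> \<le> 1/2"
    and s: "s = sqrt (s_rad \<theta>)"
    and a: "a = (- 6191 + 932160 * \<theta> - 1065024 * \<theta>^2 - s) / (32 * (151 - 12928 * \<theta> + 8256 * \<theta>^2))"
    and b: "b = (139055 - 1197888 * \<theta> + 1065024 * \<theta>^2 + s) / (32 * (4521 + 3584 * \<theta> - 8256 * \<theta>^2))"
begin

definition "D1 = 32 * (151 - 12928 * \<theta> + 8256 * \<theta>^2)"
definition "D2 = 32 * (4521 + 3584 * \<theta> - 8256 * \<theta>^2)"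
text \<open>Polynomials in \<open>\<theta>\<close> with large alternating coefficients are estimated after expansion at 1/2,
  where the powers of \<open>h\<close> beyond the first are negligible.\<close>

lemma half_gap:
  obtains h where "0 \<le> h" "h \<le> 38/10000" "0 \<le> h\<^sup>2" "h\<^sup>2 \<le> 1444/100000000" "\<theta> = 1/2 - h" "\<theta>\<^sup>2 = 1/4 - h + h\<^sup>2"
proof (rule that[of "1/2 - \<theta>"])
  show *: "0 \<le> 1/2 - \<theta>" "1/2 - \<theta> \<le> 38/10000"
    using \<theta> by auto
  show "(1/2 - \<theta>)\<^sup>2 \<le> 1444/100000000"
    using power_mono[OF *(2,1), of 2] by (simp add: power_divide)
  show "\<theta>\<^sup>2 = 1/4 - (1/2 - \<theta>) + (1/2 - \<theta>)\<^sup>2"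
    by (simp add: power2_eq_square algebra_simps)
qed auto

lemma s_bounds: "300770 \<le> s" "s \<le> 300800" "s\<^sup>2 = s_rad \<theta>"
proof -
  obtain h where h: "0 \<le> h\<^sup>2" "h\<^sup>2 \<le> 1444/100000000" "\<theta> = 1/2 - h"
    by (rule half_gap)
  have rad_eq: "s_rad \<theta> = (245569 - 1065024 * h\<^sup>2) * (368449 - 1556544 * h\<^sup>2)"
    by (simp add: s_rad_def h(3) power2_eq_square algebra_simps)
  have "(245553::real) * 368426 \<le> s_rad \<theta>"
    unfolding rad_eq using h by (intro mult_mono) auto
  then have low: "300770\<^sup>2 \<le> s_rad \<theta>"
    by simp
  have "s_rad \<theta> \<le> 245569 * 368449"
    unfolding rad_eq using h by (intro mult_mono) auto
  then have "s_rad \<theta> \<le> 300800\<^sup>2"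
    by simp
  then show "s \<le> 300800"
    unfolding s by (intro real_le_lsqrt) auto
  show "300770 \<le> s"
    unfolding s using low by (intro real_le_rsqrt) auto
  show "s\<^sup>2 = s_rad \<theta>"
    unfolding s using low by (intro real_sqrt_pow2) simp
qed

lemma D_bounds: "D1 < - 135000" "D2 > 135000"
proof -
  obtain h where h: "0 \<le> h" "h \<le> 38/10000" "0 \<le> h\<^sup>2" "h\<^sup>2 \<le> 1444/100000000"
    "\<theta> = 1/2 - h" "\<theta>\<^sup>2 = 1/4 - h + h\<^sup>2"
    by (rule half_gap)
  show "D1 < - 135000" "D2 > 135000"
    unfolding D1_def D2_def unfolding h(6) unfolding h(5) using h(1-4) by auto
qed

lemma a_mult: "a * D1 = - 6191 + 932160 * \<theta> - 1065024 * \<theta>^2 - s"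
  and b_mult: "b * D2 = 139055 - 1197888 * \<theta> + 1065024 * \<theta>^2 + s"
  using D_bounds unfolding a b D1_def D2_def by (simp_all add: field_simps)

lemma a_box: "a \<in> {787/1000..789/1000}"
proof -
  obtain h where h: "0 \<le> h" "h \<le> 38/10000" "0 \<le> h\<^sup>2" "h\<^sup>2 \<le> 1444/100000000"
    "\<theta> = 1/2 - h" "\<theta>\<^sup>2 = 1/4 - h + h\<^sup>2"
    by (rule half_gap)
  have "a * D1 \<le> 787/1000 * D1"
    unfolding a_mult unfolding D1_def unfolding h(6) unfolding h(5) using h(1-4) s_bounds(1,2) by argo
  moreover have "789/1000 * D1 \<le> a * D1"
    unfolding a_mult unfolding D1_def unfolding h(6) unfolding h(5) using h(1-4) s_bounds(1,2) by argo
  ultimately show ?thesis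
    using D_bounds by (auto simp: mult_le_cancel_right)
qed

lemma b_box: "b \<in> {787/1000..789/1000}"
proof -
  obtain h where h: "0 \<le> h" "h \<le> 38/10000" "0 \<le> h\<^sup>2" "h\<^sup>2 \<le> 1444/100000000"
    "\<theta> = 1/2 - h" "\<theta>\<^sup>2 = 1/4 - h + h\<^sup>2"
    by (rule half_gap)
  have "787/1000 * D2 \<le> b * D2"
    unfolding b_mult unfolding D2_def unfolding h(6) unfolding h(5) using h(1-4) s_bounds(1,2) by argo
  moreover have "b * D2 \<le> 789/1000 * D2"
    unfolding b_mult unfolding D2_def unfolding h(6) unfolding h(5) using h(1-4) s_bounds(1,2) by argo
  ultimately show ?thesis
    using D_bounds by (auto simp: mult_le_cancel_right)
qed

lemmas bilinear = bilinear_at_critical_point[OF a_mult b_mult s_bounds(3)]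

lemma effect_A_zero: "effect_A \<theta> a b = 0"
proof -
  have "D1 * D2 * effect_A \<theta> a b = 0"
    unfolding effect_A_def bilinear unfolding D1_def D2_def s_rad_def by (simp add: algebra_simps eval_nat_numeral)
  then show ?thesis
    using D_bounds by auto
qed

lemma effect_B_zero: "effect_B \<theta> a b = 0"
proof -
  have eq: "effect_B \<theta> a b = (3194880 * \<theta> - 529152) + (176384 - 3434496 * \<theta>) * a
     + 479232 * b + (- 159744 - 425984 * \<theta>) * a * b"
    by (simp add: effect_B_def algebra_simps)
  have "D1 * D2 * effect_B \<theta> a b = 0"
    unfolding eq bilinear unfolding D1_def D2_def s_rad_def by (simp add: algebra_simps eval_nat_numeral)
  then show ?thesis
    using D_bounds by auto
qed

lemma table_payoff_value:
  "D1 * D2 * table_payoff \<theta> a b = - 512 *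
    ((94430296089921 - 6646323952883456 * \<theta> - 25262343281817856 * \<theta>^2
     + 63817334469402624 * \<theta>^3 - 31908667234701312 * \<theta>^4)
     - 3 * (980324411 - 4975425984 * \<theta> * (1 - \<theta>)) * s)"
  unfolding table_payoff_def bilinear unfolding D1_def D2_def s_rad_def by (simp add: algebra_simps eval_nat_numeral)

text \<open>Partial derivatives at \<open>(a, b)\<close> of \<open>table_payoff\<close>, \<open>effect_A\<close> and \<open>effect_B\<close> with respect to the
  two Players' probabilities.\<close>

definition "Lx = (23135856 * \<theta> - 10015232) + 45056 * b"
definition "Ly = (13120624 - 23135856 * \<theta>) + 45056 * a"
definition "Ax = 479232 + (425984 * \<theta> - 585728) * b"
definition "Ay = (3434496 * \<theta> - 3258112) + (425984 * \<theta> - 585728) * a"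
definition "Bx = (176384 - 3434496 * \<theta>) - (159744 + 425984 * \<theta>) * b"
definition "By = 479232 - (159744 + 425984 * \<theta>) * a"

lemma slope_condition:
  "D1 * D2 * ((Lx + Ax) * By - (Ly + Ay) * Bx) = 81788928 *
     ((- 60839913271071 + 6651690601235800 * \<theta> - 30653458974444288 * \<theta>^2 + 14463437846157312 * \<theta>^3
       + 51767675423797248 * \<theta>^4 - 42391584665468928 * \<theta>^5)
      + (- 2785433871 - 6084287594 * \<theta> + 19661062288 * \<theta>^2 + 53224995456 * \<theta>^3 - 54218142720 * \<theta>^4) * s)"
  (is "_ = 81788928 * (?A + ?B * s)")
proof -
  have eq: "(Lx + Ax) * By - (Ly + Ay) * Bx =
    (- 6309545668608 + 48435205238784 * \<theta> - 67664242114560 * \<theta>^2)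
    + (1618684674048 - 1565703340032 * \<theta> - 8392464138240 * \<theta>^2) * a
    + (1316369793024 + 1258243424256 * \<theta> - 8392464138240 * \<theta>^2) * b + 0 * a * b"
    unfolding Lx_def Ly_def Ax_def Ay_def Bx_def By_def by (simp add: algebra_simps eval_nat_numeral)
  show ?thesis
    unfolding eq bilinear unfolding D1_def D2_def s_rad_def by (simp add: algebra_simps eval_nat_numeral)
qed

text \<open>Up to a constant factor, the norm of the right-hand side of \<open>slope_condition\<close> over the field of rational functions. This
  is where \<open>theta_poly\<close> comes from.\<close>

lemma norm_identity:
  "(- 60839913271071 + 6651690601235800 * \<theta> - 30653458974444288 * \<theta>^2 + 14463437846157312 * \<theta>^3
       + 51767675423797248 * \<theta>^4 - 42391584665468928 * \<theta>^5)\<^sup>2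
   - (- 2785433871 - 6084287594 * \<theta> + 19661062288 * \<theta>^2 + 53224995456 * \<theta>^3 - 54218142720 * \<theta>^4)\<^sup>2 * s_rad \<theta>
   = (2730684 - 231625216 * \<theta> - 41020928 * \<theta>^2 + 545292288 * \<theta>^3 - 272646144 * \<theta>^4) *
   (139587367297173051168 - 135782955080259495272577 * \<theta> + 1873662221810254572134561 * \<theta>^2
     - 6306085403811779286897552 * \<theta>^3 + 3889005095548638820291008 * \<theta>^4 + 4461194696950345843390464 * \<theta>^5
     + 13439789031937874190594048 * \<theta>^6 - 35092289343041827660431360 * \<theta>^7 + 17873545461788238682521600 * \<theta>^8)"
  unfolding s_rad_def by (simp add: algebra_simps eval_nat_numeral)


text \<open>The hypothesis is that \<open>theta_poly\<close> is positive at \<open>\<theta>\<close>. Since the quartic factor of the norm is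
  negative, the square root term dominates, and its coefficient is positive.\<close>

lemma slope_negative:
  assumes "139587367297173051168 - 135782955080259495272577 * \<theta> + 1873662221810254572134561 * \<theta>^2
     - 6306085403811779286897552 * \<theta>^3 + 3889005095548638820291008 * \<theta>^4 + 4461194696950345843390464 * \<theta>^5
     + 13439789031937874190594048 * \<theta>^6 - 35092289343041827660431360 * \<theta>^7 + 17873545461788238682521600 * \<theta>^8 > 0"
    (is "?P > 0")
  shows "(Lx + Ax) * By - (Ly + Ay) * Bx < 0"
proof -
  obtain h where h: "0 \<le> h" "h \<le> 38/10000" "0 \<le> h\<^sup>2" "h\<^sup>2 \<le> 1444/100000000" "\<theta> = 1/2 - h"
    by (rule half_gap)
  \<comment> \<open>the norm \<open>A\<^sup>2 - B\<^sup>2 * s\<^sup>2\<close> is negative while \<open>B * s\<close> is positive\<close>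
  define A where "A = - 60839913271071 + 6651690601235800 * \<theta> - 30653458974444288 * \<theta>^2
    + 14463437846157312 * \<theta>^3 + 51767675423797248 * \<theta>^4 - 42391584665468928 * \<theta>^5"
  define B where "B = - 2785433871 - 6084287594 * \<theta> + 19661062288 * \<theta>^2
    + 53224995456 * \<theta>^3 - 54218142720 * \<theta>^4"
  define Q where "Q = 2730684 - 231625216 * \<theta> - 41020928 * \<theta>^2 + 545292288 * \<theta>^3 - 272646144 * \<theta>^4"
  have h4: "h^4 \<le> 1" "0 \<le> h^3" "0 \<le> h^4"
    using h(1,2) by (auto intro: power_le_one)
  have "B = 2352178416 - 26386449926 * h + 18171341392 * h^2 + 55211289984 * h^3 - 54218142720 * h^4"
    unfolding B_def h(5) by (simp add: field_simps eval_nat_numeral)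
  moreover have "h^4 \<le> h^2"
    using h(1,2) by (intro power_decreasing) auto
  ultimately have B: "B > 0"
    using h h4 by argo
  have "Q = - 72216004 + 367948288 * h^2 - 272646144 * h^4"
    unfolding Q_def h(5) by (simp add: field_simps eval_nat_numeral)
  then have "Q < 0"
    using h h4 by argo
  then have "A\<^sup>2 - B\<^sup>2 * s_rad \<theta> < 0"
    using assms unfolding A_def B_def norm_identity Q_def[symmetric] by (simp add: mult_less_0_iff)
  then have "(- A)\<^sup>2 < (B * s)\<^sup>2"
    using s_bounds(3) by (simp add: power_mult_distrib)
  moreover have "0 \<le> B * s"
    using B s_bounds(1) by simp
  ultimately have "- A < B * s"
    by (rule power2_less_imp_less)
  then have "D1 * D2 * ((Lx + Ax) * By - (Ly + Ay) * Bx) > 0"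
    unfolding slope_condition A_def B_def by simp
  then show ?thesis
    using D_bounds by (simp add: zero_less_mult_iff)
qed

lemma neg_combination:
  fixes x y u v :: real
  assumes "u < 0" "v < 0" "0 \<le> x" "0 \<le> y" "x \<noteq> 0 \<or> y \<noteq> 0"
  shows "u * x + v * y < 0"
proof (cases "x = 0")
  case False
  then show ?thesis
    using assms by (intro add_neg_nonpos mult_neg_pos mult_nonpos_nonneg) auto
qed (use assms in \<open>simp add: mult_neg_pos\<close>)

lemma mult_bounds:
  fixes x y :: real
  assumes "l \<le> x" "x \<le> u" "l' \<le> y" "y \<le> u'" "0 \<le> l" "0 \<le> l'"
  shows "l * l' \<le> x * y" "x * y \<le> u * u'"
  using assms by (intro mult_mono; simp)+

lemma slope_bounds:
  shows "1500000 \<le> Lx" "Lx \<le> 1588300" "1588000 \<le> Ly" "Ly \<le> 1676300"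
    "183000 \<le> Ax" "Ax \<le> 186000" "- 1849400 \<le> Ay" "Ay \<le> - 1834100"
    "- 1835000 \<le> Bx" "Bx \<le> - 1819800" "185000 \<le> By" "By \<le> 187200"
proof -
  have ab: "787/1000 \<le> a" "a \<le> 789/1000" "787/1000 \<le> b" "b \<le> 789/1000"
    using a_box b_box by auto
  have c: "372736 \<le> 585728 - 425984 * \<theta>" "585728 - 425984 * \<theta> \<le> 374355"
    and d: "371117 \<le> 159744 + 425984 * \<theta>" "159744 + 425984 * \<theta> \<le> 372736"
    using \<theta> by auto
  note p = mult_bounds[OF c ab(1,2)] mult_bounds[OF c ab(3,4)]
    mult_bounds[OF d ab(1,2)] mult_bounds[OF d ab(3,4)]
  have neg: "(425984 * \<theta> - 585728) * x = - ((585728 - 425984 * \<theta>) * x)" for x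
    by (simp add: algebra_simps)
  show "1500000 \<le> Lx" "Lx \<le> 1588300" "1588000 \<le> Ly" "Ly \<le> 1676300"
    using ab \<theta> unfolding Lx_def Ly_def by auto
  show "183000 \<le> Ax" "Ax \<le> 186000" "- 1849400 \<le> Ay" "Ay \<le> - 1834100"
    using p \<theta> unfolding Ax_def Ay_def neg by auto
  show "- 1835000 \<le> Bx" "Bx \<le> - 1819800" "185000 \<le> By" "By \<le> 187200"
    using p \<theta> unfolding Bx_def By_def by auto
qed

text \<open>Cramer's rule. Only \<open>l \<le> 1\<close> is delicate, since \<open>l\<close> reaches 1 at the threshold; the remaining
  inequalities hold with room to spare. The bound \<open>1/2 \<le> m\<close> is what later makes
  the mixed term of \<open>L + l * A + m * B\<close> negative.\<close>

lemma multipliers: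
  assumes "(Lx + Ax) * By - (Ly + Ay) * Bx < 0"
  obtains l m where "0 \<le> l" "l \<le> 1" "1/2 \<le> m" "m \<le> 1"
    "Lx + l * Ax + m * Bx = 0" "Ly + l * Ay + m * By = 0"
proof -
  define det where "det = Ay * Bx - Ax * By"
  note sb = slope_bounds
  have AyBx: "1834100 * 1819800 \<le> (- Ay) * (- Bx)"
    using sb by (intro mult_mono) auto
  have AxBy: "Ax * By \<le> 186000 * 187200" "0 \<le> Ax * By"
    using sb by (intro mult_mono mult_nonneg_nonneg; simp)+
  have det: "det > 0"
    using AyBx AxBy by (simp add: det_def)
  show thesis
  proof
    have "0 \<le> Lx * By" "0 \<le> Ly * (- Bx)"
      using sb by (intro mult_nonneg_nonneg; simp)+
    then show "0 \<le> (Lx * By - Ly * Bx) / det"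
      using det by simp
    show "(Lx * By - Ly * Bx) / det \<le> 1"
      using det assms by (simp add: det_def algebra_simps)
    have "0 \<le> Ax * Ly"
      using sb by (intro mult_nonneg_nonneg) auto
    moreover have "0 \<le> (- Ay) * (2 * Lx + Bx)"
      using sb by (intro mult_nonneg_nonneg) auto
    ultimately have "det \<le> 2 * (Ax * Ly - Ay * Lx)"
      using AxBy by (simp add: det_def algebra_simps)
    then show "1/2 \<le> (Ax * Ly - Ay * Lx) / det"
      using det by (simp add: field_simps)
    have "Ax * (Ly + By) \<le> 186000 * (1676300 + 187200)"
      using sb by (intro mult_mono) auto
    moreover have "1834100 * (1819800 - 1588300) \<le> (- Ay) * (- Bx - Lx)"
      using sb by (intro mult_mono) auto
    ultimately have "Ax * Ly - Ay * Lx \<le> det"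
      by (simp add: det_def algebra_simps)
    then show "(Ax * Ly - Ay * Lx) / det \<le> 1"
      using det by simp
    show "Lx + (Lx * By - Ly * Bx) / det * Ax + (Ax * Ly - Ay * Lx) / det * Bx = 0"
      "Ly + (Lx * By - Ly * Bx) / det * Ay + (Ax * Ly - Ay * Lx) / det * By = 0"
      using det by (simp_all add: field_simps) (simp_all add: det_def algebra_simps)
  qed
qed

lemma table_payoff_expand:
  "table_payoff \<theta> r1 r2 = table_payoff \<theta> a b + Lx * (r1 - a) + Ly * (r2 - b)
     + 45056 * ((r1 - a) * (r2 - b))"
  by (simp add: table_payoff_def Lx_def Ly_def algebra_simps)

lemma effect_A_expand:
  "effect_A \<theta> r1 r2 = Ax * (r1 - a) + Ay * (r2 - b)
     - (585728 - 425984 * \<theta>) * ((r1 - a) * (r2 - b))"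
  using effect_A_zero by (simp add: effect_A_def Ax_def Ay_def algebra_simps)

lemma effect_B_expand:
  "effect_B \<theta> r1 r2 = Bx * (r1 - a) + By * (r2 - b)
     - (159744 + 425984 * \<theta>) * ((r1 - a) * (r2 - b))"
  using effect_B_zero by (simp add: effect_B_def Bx_def By_def algebra_simps)

text \<open>The left-hand side is the least of the payoffs of the four tabulated strategies. If both Players
  deviate in the same direction it is at most the weighted mean with the multipliers as weights,
  which has no linear part. If Player 1 draws more often and Player 2 less often, Banker should draw
  at \<open>(10, 6, 6)\<close> and stand at \<open>(6, 10, 6)\<close>; in the opposite case the roles are exchanged.\<close>

lemma best_reply_bound:
  assumes slope: "(Lx + Ax) * By - (Ly + Ay) * Bx < 0"
    and r: "0 \<le> r1" "r1 \<le> 1" "0 \<le> r2" "r2 \<le> 1" "(r1, r2) \<noteq> (a, b)"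
  shows "table_payoff \<theta> r1 r2 + min 0 (effect_A \<theta> r1 r2) + min 0 (effect_B \<theta> r1 r2)
    < table_payoff \<theta> a b"
proof -
  define X Y where "X = r1 - a" and "Y = r2 - b"
  define c d where "c = 585728 - 425984 * \<theta>" and "d = 159744 + 425984 * \<theta>"
  have XY: "X \<le> 1" "Y \<le> 1" "X \<noteq> 0 \<or> Y \<noteq> 0"
    using r a_box b_box by (auto simp: X_def Y_def)
  have cd: "372736 \<le> c" "c \<le> 374355" "371117 \<le> d" "d \<le> 372736"
    using \<theta> by (auto simp: c_def d_def)
  note L = table_payoff_expand[of r1 r2, folded X_def Y_def]
    and A = effect_A_expand[of r1 r2, folded X_def Y_def c_def]
    and B = effect_B_expand[of r1 r2, folded X_def Y_def d_def]
  note sb = slope_bounds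
  \<comment> \<open>stationarity helps only where the mixed term has a favourable sign\<close>
  consider (same) "X * Y > 0" | (pn) "X \<ge> 0" "Y \<le> 0" | (np) "X \<le> 0" "Y \<ge> 0"
    by (metis linorder_le_cases mult_pos_pos mult_neg_neg less_eq_real_def)
  then show ?thesis
  proof cases
    case same
    obtain l m where lm: "0 \<le> l" "l \<le> 1" "1/2 \<le> m" "m \<le> 1"
      and crit: "Lx + l * Ax + m * Bx = 0" "Ly + l * Ay + m * By = 0"
      using multipliers[OF slope] by blast
    have min_le: "min 0 x \<le> t * x" if "0 \<le> t" "t \<le> 1" for t x :: real
      using that by (cases "x \<ge> 0") (auto simp: min_def mult_le_cancel_right1)
    have "table_payoff \<theta> r1 r2 + l * effect_A \<theta> r1 r2 + m * effect_B \<theta> r1 r2 =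
      table_payoff \<theta> a b + (Lx + l * Ax + m * Bx) * X + (Ly + l * Ay + m * By) * Y
        + (45056 - l * c - m * d) * (X * Y)"
      unfolding L A B by (simp add: algebra_simps)
    also have "\<dots> = table_payoff \<theta> a b + (45056 - l * c - m * d) * (X * Y)"
      by (simp add: crit)
    also have "\<dots> < table_payoff \<theta> a b"
    proof -
      have "1/2 * 371117 \<le> m * d" "0 \<le> l * c"
        using lm cd by (intro mult_mono mult_nonneg_nonneg; simp)+
      then show ?thesis
        using same by (simp add: mult_less_0_iff)
    qed
    finally show ?thesis
      using min_le[OF lm(1,2), of "effect_A \<theta> r1 r2"] min_le[of m "effect_B \<theta> r1 r2"] lm
      by linarith
  next
    case pn
    have "min 0 (effect_A \<theta> r1 r2) + min 0 (effect_B \<theta> r1 r2) \<le> effect_B \<theta> r1 r2"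
      by simp
    moreover have "table_payoff \<theta> r1 r2 + effect_B \<theta> r1 r2 =
      table_payoff \<theta> a b + (Lx + Bx) * X + (- (Ly + By) + (d - 45056) * X) * (- Y)"
      unfolding L B by (simp add: algebra_simps)
    moreover have "(Lx + Bx) * X + (- (Ly + By) + (d - 45056) * X) * (- Y) < 0"
    proof -
      have "(d - 45056) * X \<le> 327680 * 1"
        using cd pn XY by (intro mult_mono) auto
      then have neg: "Lx + Bx < 0" "- (Ly + By) + (d - 45056) * X < 0"
        using sb by auto
      show ?thesis
        by (rule neg_combination [OF neg]) (use pn XY(3) in auto)
    qed
    ultimately show ?thesis
      by linarith
  next
    case np
    have "min 0 (effect_A \<theta> r1 r2) + min 0 (effect_B \<theta> r1 r2) \<le> effect_A \<theta> r1 r2"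
      by simp
    moreover have "table_payoff \<theta> r1 r2 + effect_A \<theta> r1 r2 =
      table_payoff \<theta> a b + (Ly + Ay) * Y + (- (Lx + Ax) + (c - 45056) * Y) * (- X)"
      unfolding L A by (simp add: algebra_simps)
    moreover have "(Ly + Ay) * Y + (- (Lx + Ax) + (c - 45056) * Y) * (- X) < 0"
    proof -
      have "(c - 45056) * Y \<le> 329299 * 1"
        using cd np XY by (intro mult_mono) auto
      then have neg: "Ly + Ay < 0" "- (Lx + Ax) + (c - 45056) * Y < 0"
        using sb by auto
      show ?thesis
        by (rule neg_combination [OF neg]) (use np XY(3) in auto)
    qed
    ultimately show ?thesis
      by linarith
  qed
qed

end

section \<open>The threshold and the maximin strategy\<close>

lemma poly_theta_poly:
  "poly theta_poly \<theta> = 139587367297173051168 - 135782955080259495272577 * \<theta>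
     + 1873662221810254572134561 * \<theta>^2 - 6306085403811779286897552 * \<theta>^3
     + 3889005095548638820291008 * \<theta>^4 + 4461194696950345843390464 * \<theta>^5
     + 13439789031937874190594048 * \<theta>^6 - 35092289343041827660431360 * \<theta>^7
     + 17873545461788238682521600 * \<theta>^8"
  by (simp add: theta_poly_def algebra_simps eval_nat_numeral)

text \<open>Expanded at 1/2, the constant coefficient dominates on the range in question; in powers of \<open>\<theta>\<close> the
  terms nearly cancel and interval bounds would be useless.\<close>

lemma poly_pderiv_theta_poly:
  "poly (pderiv theta_poly) (1/2 - h) = 145778992397379525928148 - 2429397212412776503179730 * h
    + 2216117189194404377594832 * h^2 + 39563215091171680539441408 * h^3
    - 71695695128439780122204160 * h^4 - 94389567382854888940412928 * h^5
    + 254813247528777889487585280 * h^6 - 142988363694305909460172800 * h^7"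
  by (simp add: theta_poly_def pderiv_pCons field_simps eval_nat_numeral)

lemma poly_theta_poly_less:
  assumes "4962/10000 \<le> x" "x < y" "y \<le> 1/2"
  shows "poly theta_poly x < poly theta_poly y"
proof (rule DERIV_pos_imp_increasing[OF assms(2)])
  fix t assume t: "x \<le> t" "t \<le> y"
  define h where "h = 1/2 - t"
  have h: "0 \<le> h" "h \<le> 38/10000"
    using t assms by (auto simp: h_def)
  have sq: "h\<^sup>2 \<le> 1444/100000000"
    using power_mono[OF h(2,1), of 2] by (simp add: power_divide)
  have "h^4 \<le> h^2" "h^5 \<le> h^2" "h^7 \<le> h^2"
    using h by (auto intro: power_decreasing)
  moreover have "0 \<le> h^2" "0 \<le> h^3" "0 \<le> h^6"
    using h by auto
  ultimately have "poly (pderiv theta_poly) (1/2 - h) > 0"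
    unfolding poly_pderiv_theta_poly using h sq by argo
  moreover have "1/2 - h = t"
    by (simp add: h_def)
  ultimately show "\<exists>d. DERIV (poly theta_poly) t :> d \<and> 0 < d"
    using poly_DERIV[of theta_poly t] by metis
qed

lemma ex1_theta_ss: "\<exists>!t. is_theta_ss t"
proof -
  let ?l = "4962115/10000000 :: real" and ?u = "4962125/10000000 :: real"
  have "poly theta_poly ?l \<le> 0" "0 \<le> poly theta_poly ?u"
    by (simp_all add: theta_poly_def)
  moreover have "continuous_on {?l..?u} (poly theta_poly)"
    by (intro continuous_at_imp_continuous_on ballI poly_isCont)
  ultimately obtain t where "?l \<le> t" "t \<le> ?u" "poly theta_poly t = 0"
    using IVT'[of "poly theta_poly" ?l 0 ?u] by auto
  then have t: "is_theta_ss t"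
    by (auto simp: is_theta_ss_def abs_if)
  moreover have "t' = t" if "is_theta_ss t'" for t'
  proof (rule ccontr)
    assume "t' \<noteq> t"
    then consider "t < t'" | "t' < t" by linarith
    then show False
      using poly_theta_poly_less[of t t'] poly_theta_poly_less[of t' t] t that
      by cases (auto simp: is_theta_ss_def abs_if split: if_splits)
  qed
  ultimately show ?thesis by blast
qed

lemma theta_ss_range: "4962/10000 \<le> theta_ss" "theta_ss < 1/2"
  and poly_theta_ss: "poly theta_poly theta_ss = 0"
proof -
  have "is_theta_ss theta_ss"
    unfolding theta_ss_def by (rule theI'[OF ex1_theta_ss])
  then show "4962/10000 \<le> theta_ss" "theta_ss < 1/2" "poly theta_poly theta_ss = 0"
    by (auto simp: is_theta_ss_def abs_if split: if_splits)
qed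

lemma special_info_sets: "(6, 10, 6) \<in> info_sets - table_draws" "(10, 6, 6) \<in> info_sets - table_draws"
  by (auto simp: info_sets_def table_draws_def banker_table_def)

lemma security_level_table_le:
  "13 ^ 9 * security_level \<theta> r1 r2 \<le>
     table_payoff \<theta> r1 r2 + min 0 (effect_A \<theta> r1 r2) + min 0 (effect_B \<theta> r1 r2)"
proof -
  define S where "S = {z \<in> {(6, 10, 6), (10, 6, 6)}. draw_effect \<theta> r1 r2 z < 0}"
  have S: "table_draws \<union> S \<subseteq> info_sets" "table_draws \<inter> S = {}" "finite S"
    using special_info_sets table_draws_subset by (auto simp: S_def)
  have fin: "finite table_draws"
    using table_draws_subset finite_info_sets by (rule finite_subset)
  have "(\<Sum>z\<in>S. draw_effect \<theta> r1 r2 z) = (\<Sum>z\<in>{(6, 10, 6), (10, 6, 6)}. min 0 (draw_effect \<theta> r1 r2 z))"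
    unfolding S_def by (rule sum.mono_neutral_cong_left) (auto simp: min_def)
  also have "\<dots> = (min 0 (effect_A \<theta> r1 r2) + min 0 (effect_B \<theta> r1 r2)) / 13 ^ 9"
    by (simp add: draw_effect_A draw_effect_B min_def)
  finally have "mixed_payoff (table_draws \<union> S) \<theta> r1 r2 = mixed_payoff table_draws \<theta> r1 r2
      + (min 0 (effect_A \<theta> r1 r2) + min 0 (effect_B \<theta> r1 r2)) / 13 ^ 9"
    using mixed_payoff_decomposition[OF S(1)] mixed_payoff_decomposition[OF table_draws_subset]
    by (simp add: sum.union_disjoint[OF fin S(3,2)])
  then show ?thesis
    using security_level_le[OF S(1), of \<theta> r1 r2] by (simp add: mixed_payoff_table field_simps)
qed

context
  fixes \<theta> :: real
  assumes range: "theta_ss < \<theta>" "\<theta> \<le> 1/2"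
begin

interpretation equalizing \<theta> "s_root \<theta>" "opt_p1 \<theta>" "opt_p2 \<theta>"
  using range theta_ss_range
  by unfold_locales (simp_all add: s_root_def s_rad_def opt_p1_def opt_p2_def)

lemma draw_effect_sign_opt:
  assumes "(k1, k2, j) \<in> info_sets"
  shows "case entry_advice (banker_table ! k1 ! k2) j of
      Draw \<Rightarrow> draw_effect \<theta> (opt_p1 \<theta>) (opt_p2 \<theta>) (k1, k2, j) < 0
    | Stand \<Rightarrow> draw_effect \<theta> (opt_p1 \<theta>) (opt_p2 \<theta>) (k1, k2, j) > 0
    | Draw_Or_Stand \<Rightarrow> (k1, k2, j) \<in> {(6, 10, 6), (10, 6, 6)} \<and>
        draw_effect \<theta> (opt_p1 \<theta>) (opt_p2 \<theta>) (k1, k2, j) = 0"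
proof -
  have "\<theta> \<in> {4962/10000..1/2}"
    using range theta_ss_range by simp
  from draw_effect_sign[OF this a_box b_box assms] show ?thesis
    using effect_A_zero effect_B_zero by (auto simp: draw_effect_A draw_effect_B split: advice.splits)
qed

lemma best_response_iff_follows_table:
  "is_best_response \<theta> (opt_p1 \<theta>) (opt_p2 \<theta>) T \<longleftrightarrow> T \<subseteq> info_sets \<and> follows_table T"
proof -
  let ?d = "draw_effect \<theta> (opt_p1 \<theta>) (opt_p2 \<theta>)"
  have *: "(?d (k1, k2, j) < 0 \<longrightarrow> (k1, k2, j) \<in> T) \<and> (?d (k1, k2, j) > 0 \<longrightarrow> (k1, k2, j) \<notin> T) \<longleftrightarrow>
      (case entry_advice (banker_table ! k1 ! k2) j of
          Draw \<Rightarrow> (k1, k2, j) \<in> T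
        | Stand \<Rightarrow> (k1, k2, j) \<notin> T
        | Draw_Or_Stand \<Rightarrow> True)" if "(k1, k2, j) \<in> info_sets" for k1 k2 j
    using draw_effect_sign_opt[OF that] by (auto split: advice.splits)
  have "(\<forall>z\<in>info_sets. (?d z < 0 \<longrightarrow> z \<in> T) \<and> (?d z > 0 \<longrightarrow> z \<notin> T)) \<longleftrightarrow> follows_table T"
    unfolding follows_table_def
  proof (intro ball_cong refl)
    fix z assume "z \<in> info_sets"
    then show "((?d z < 0 \<longrightarrow> z \<in> T) \<and> (?d z > 0 \<longrightarrow> z \<notin> T)) =
        (case z of (k1, k2, j) \<Rightarrow> case entry_advice (banker_table ! k1 ! k2) j of
          Draw \<Rightarrow> (k1, k2, j) \<in> T
        | Stand \<Rightarrow> (k1, k2, j) \<notin> T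
        | Draw_Or_Stand \<Rightarrow> True)"
      using * by (cases z) simp
  qed
  then show ?thesis
    unfolding is_best_response_iff by simp
qed

lemma indifferent_sets:
  "{z \<in> info_sets. banker_indifferent \<theta> (opt_p1 \<theta>) (opt_p2 \<theta>) z} = {(6, 10, 6), (10, 6, 6)}"
proof -
  have "z \<in> {(6, 10, 6), (10, 6, 6)}"
    if "z \<in> info_sets" "draw_effect \<theta> (opt_p1 \<theta>) (opt_p2 \<theta>) z = 0" for z
    using that draw_effect_sign_opt[of "fst z" "fst (snd z)" "snd (snd z)"]
    by (auto split: advice.splits)
  then show ?thesis
    using special_info_sets
    by (intro set_eqI iffI)
       (use banker_indifferent_iff in blast,
        auto simp: banker_indifferent_iff draw_effect_A draw_effect_B effect_A_zero effect_B_zero)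
qed

lemma security_level_opt:
  "security_level \<theta> (opt_p1 \<theta>) (opt_p2 \<theta>) = table_payoff \<theta> (opt_p1 \<theta>) (opt_p2 \<theta>) / 13 ^ 9"
proof -
  have "follows_table table_draws"
    by (auto simp: follows_table_def table_draws_def split: advice.splits)
  then show ?thesis
    using security_level_eq best_response_iff_follows_table table_draws_subset mixed_payoff_table
    by metis
qed

lemma security_level_less:
  assumes "r1 \<in> {0..1}" "r2 \<in> {0..1}" "(r1, r2) \<noteq> (opt_p1 \<theta>, opt_p2 \<theta>)"
  shows "security_level \<theta> r1 r2 < security_level \<theta> (opt_p1 \<theta>) (opt_p2 \<theta>)"
proof -
  have "poly theta_poly \<theta> > 0"
    using poly_theta_poly_less[OF theta_ss_range(1) range] poly_theta_ss by simp
  then have "(Lx + Ax) * By - (Ly + Ay) * Bx < 0"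
    unfolding poly_theta_poly by (rule slope_negative)
  from best_reply_bound[OF this, of r1 r2] assms show ?thesis
    using security_level_table_le[of \<theta> r1 r2] by (simp add: security_level_opt field_simps)
qed

lemma maximin_opt:
  "is_maximin \<theta> p1 p2 \<longleftrightarrow> p1 = opt_p1 \<theta> \<and> p2 = opt_p2 \<theta>"
  "lower_value \<theta> = security_level \<theta> (opt_p1 \<theta>) (opt_p2 \<theta>)"
  using strict_maximin[of "opt_p1 \<theta>" "opt_p2 \<theta>" \<theta>] security_level_less a_box b_box by auto

lemma lower_value_formula:
  "lower_value \<theta> =
     - ((N_poly \<theta> - 3 * (980324411 - 4975425984 * \<theta> * (1 - \<theta>)) * s_root \<theta>)
        / (21208998746 * (151 - 12928 * \<theta> + 8256 * \<theta>^2) * (4521 + 3584 * \<theta> - 8256 * \<theta>^2)))"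
proof -
  define d1 d2 where "d1 = 151 - 12928 * \<theta> + 8256 * \<theta>^2" and "d2 = 4521 + 3584 * \<theta> - 8256 * \<theta>^2"
  have D: "D1 = 32 * d1" "D2 = 32 * d2"
    by (simp_all add: D1_def D2_def d1_def d2_def)
  then have nz: "d1 \<noteq> 0" "d2 \<noteq> 0"
    using D_bounds by auto
  define n where "n = N_poly \<theta> - 3 * (980324411 - 4975425984 * \<theta> * (1 - \<theta>)) * s_root \<theta>"
  have "D1 * D2 * table_payoff \<theta> (opt_p1 \<theta>) (opt_p2 \<theta>) = - 512 * n"
    unfolding table_payoff_value by (simp add: n_def N_poly_def)
  then have "table_payoff \<theta> (opt_p1 \<theta>) (opt_p2 \<theta>) = - n / (2 * d1 * d2)"
    using nz unfolding D by (simp add: field_simps)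
  then show ?thesis
    unfolding maximin_opt security_level_opt d1_def[symmetric] d2_def[symmetric] n_def[symmetric]
    by simp
qed

end

lemma s_root_half: "s_root (1/2) = 607 * sqrt 245569"
proof -
  have "s_root (1/2) = sqrt (607\<^sup>2 * 245569)"
    by (simp add: s_root_def)
  then show ?thesis
    unfolding real_sqrt_mult real_sqrt_abs by simp
qed

lemma opt_half: "opt_p1 (1/2) = (- 319 + sqrt 245569) / 224" "opt_p2 (1/2) = (- 319 + sqrt 245569) / 224"
  by (simp_all add: opt_p1_def opt_p2_def s_root_half power_divide field_simps)

theorem mainTheorem7:
  shows "(\<exists>!t. is_theta_ss t) \<and>
    (\<forall>\<theta>::real. theta_ss < \<theta> \<and> \<theta> \<le> 1 / 2 \<longrightarrow>
       (\<forall>p1 p2. is_maximin \<theta> p1 p2 \<longleftrightarrow> p1 = opt_p1 \<theta> \<and> p2 = opt_p2 \<theta>) \<and>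
       (\<forall>T. is_best_response \<theta> (opt_p1 \<theta>) (opt_p2 \<theta>) T \<longleftrightarrow>
              T \<subseteq> info_sets \<and> follows_table T) \<and>
       {z \<in> info_sets. banker_indifferent \<theta> (opt_p1 \<theta>) (opt_p2 \<theta>) z} = {(6, 10, 6), (10, 6, 6)} \<and>
       lower_value \<theta> =
         - ((N_poly \<theta> - 3 * (980324411 - 4975425984 * \<theta> * (1 - \<theta>)) * s_root \<theta>)
            / (21208998746 * (151 - 12928 * \<theta> + 8256 * \<theta>^2) * (4521 + 3584 * \<theta> - 8256 * \<theta>^2)))) \<and>
    (\<forall>p1 p2. is_maximin (1 / 2) p1 p2 \<longleftrightarrow>
       p1 = (- 319 + sqrt 245569) / 224 \<and> p2 = (- 319 + sqrt 245569) / 224) \<and>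
    lower_value (1 / 2) = 5 * (- 1933207795 + 260493 * sqrt 245569) / (98 * 13 ^ 9)"
proof (intro conjI allI impI)
  show "\<exists>!t. is_theta_ss t"
    by (rule ex1_theta_ss)
next
  fix p1 p2
  show "is_maximin (1 / 2) p1 p2 \<longleftrightarrow>
       p1 = (- 319 + sqrt 245569) / 224 \<and> p2 = (- 319 + sqrt 245569) / 224"
    using maximin_opt(1)[of "1/2"] theta_ss_range(2) by (simp add: opt_half)
next
  show "lower_value (1 / 2) = 5 * (- 1933207795 + 260493 * sqrt 245569) / (98 * 13 ^ 9)"
    using lower_value_formula[of "1/2"] theta_ss_range(2)
    by (simp add: s_root_half N_poly_def field_simps)
qed (simp_all add: maximin_opt(1) best_response_iff_follows_table indifferent_sets lower_value_formula)

end
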